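(* Let $H\in(1/2,1)$, let $B^H$ be a fractional Brownian motion with Hurst parameter $H$, and let $X=\{X_k\}_{k\ge 0}$, $X_k=B^H_{k+1}-B^H_k$, be its discrete increment process (fractional Gaussian noise). Then the excess entropy of $X$ is infinite.
   Context: Fractional Brownian motion with Hurst parameter $H\in(0,1)$ is the centered continuous-time Gaussian process $(B^H_t)_{t\ge0}$ with covariance $\mathbb{E}[B^H_tB^H_s]=\frac12\big(|t|^{2H}+|s|^{2H}-|t-s|^{2H}\big)$ for $s,t\ge0$. Its increment process (fractional Gaussian noise) is the centered stationary Gaussian process with autocovariance $\rho_k=\mathbb{E}[X_{n+k}X_n]=\frac12\big(|k-1|^{2H}-2|k|^{2H}+|k+1|^{2H}\big)$, $k\in\mathbb{Z}$. Entropy notation (not to be confused with the Hurst parameter $H$): let $H_X(n)$ be the differential entropy $-\int p_n\log p_n$ of the joint density $p_n$ of $n$ consecutive variables of $X$; for a stationary Gaussian process with autocovariance $\rho$ this equals $\frac12\log\big((2\pi e)^n\det K^{(n)}\big)$, $K^{(n)}=(\rho_{i-j})_{1\le i,j\le n}$. Put $H_X(0):=0$, $h(n):=H_X(n)-H_X(n-1)$, and let the entropy rate be $h_\mu:=\lim_{n\to\infty}H_X(n)/n$. The excess entropy is $E:=\sum_{n=1}^\infty(h(n)-h_\mu)\in[0,+\infty]$. *)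

theory Defs
  imports "HOL-Probability.Probability"
begin

(* Degenerate (constant) normal laws are included, since B_0 = 0 almost surely and arbitrary
   linear combinations of a Gaussian process may vanish. *)
definition gaussian_rv :: "'a measure \<Rightarrow> ('a \<Rightarrow> real) \<Rightarrow> bool" where
  "gaussian_rv M Y \<longleftrightarrow>
     (\<exists>\<mu> \<sigma>. 0 < \<sigma> \<and> distributed M lborel Y (\<lambda>x. ennreal (normal_density \<mu> \<sigma> x))) \<or>
     (\<exists>\<mu>. Y \<in> borel_measurable M \<and> distr M borel Y = return borel \<mu>)"

definition gaussian_process :: "'a measure \<Rightarrow> 't set \<Rightarrow> ('t \<Rightarrow> 'a \<Rightarrow> real) \<Rightarrow> bool" where
  "gaussian_process M T X \<longleftrightarrow>
     (\<forall>S c. finite S \<longrightarrow> S \<subseteq> T \<longrightarrow> gaussian_rv M (\<lambda>\<omega>. \<Sum>t\<in>S. c t * X t \<omega>))"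

(* The process is indexed by t >= 0; values of B at negative times are unconstrained. *)
definition fractional_brownian_motion ::
  "'a measure \<Rightarrow> real \<Rightarrow> (real \<Rightarrow> 'a \<Rightarrow> real) \<Rightarrow> bool" where
  "fractional_brownian_motion M H B \<longleftrightarrow>
     0 < H \<and> H < 1 \<and>
     gaussian_process M {0..} B \<and>
     (\<forall>t\<ge>0. integral\<^sup>L M (B t) = 0) \<and>
     (\<forall>t\<ge>0. \<forall>s\<ge>0. integral\<^sup>L M (\<lambda>\<omega>. B t \<omega> * B s \<omega>) =
        (\<bar>t\<bar> powr (2 * H) + \<bar>s\<bar> powr (2 * H) - \<bar>t - s\<bar> powr (2 * H)) / 2)"

definition fractional_gaussian_noise :: "(real \<Rightarrow> 'a \<Rightarrow> real) \<Rightarrow> nat \<Rightarrow> 'a \<Rightarrow> real" where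
  "fractional_gaussian_noise B k \<omega> = B (real k + 1) \<omega> - B (real k) \<omega>"

(* Differential entropy (natural logarithm) of (X 0, ..., X (n - 1)) with respect to Lebesgue
   measure on R^n, realised as a product measure on extensional functions on {..<n}. When the
   joint law has a density p, the library's entropy is the integral of - p log p, by
   entropy_distr. The value at n = 0 is a convention. *)
definition block_entropy :: "'a measure \<Rightarrow> (nat \<Rightarrow> 'a \<Rightarrow> real) \<Rightarrow> nat \<Rightarrow> real" where
  "block_entropy M X n =
     (if n = 0 then 0
      else prob_space.entropy M (exp 1) (\<Pi>\<^sub>M k\<in>{..<n}. (lborel :: real measure))
             (\<lambda>\<omega>. \<lambda>k\<in>{..<n}. X k \<omega>))"

(* Only meaningful for n >= 1. *)
definition entropy_gain :: "'a measure \<Rightarrow> (nat \<Rightarrow> 'a \<Rightarrow> real) \<Rightarrow> nat \<Rightarrow> real" where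
  "entropy_gain M X n = block_entropy M X n - block_entropy M X (n - 1)"

definition entropy_rate :: "'a measure \<Rightarrow> (nat \<Rightarrow> 'a \<Rightarrow> real) \<Rightarrow> real" where
  "entropy_rate M X = lim (\<lambda>n. block_entropy M X n / real n)"

(* The sum over n >= 1, shifted to start at index 0, taken in the extended reals. *)
definition excess_entropy :: "'a measure \<Rightarrow> (nat \<Rightarrow> 'a \<Rightarrow> real) \<Rightarrow> ereal" where
  "excess_entropy M X = (\<Sum>n. ereal (entropy_gain M X (Suc n) - entropy_rate M X))"

end

theory Submission
  imports Defs
begin

text \<open>
  Let \<open>\<sigma>\<^sup>2\<^sub>n\<close> be the variance of the error in predicting \<open>X\<^sub>n\<close> linearly from \<open>X\<^sub>0, \<dots>, X\<^sub>n\<^sub>-\<^sub>1\<close>. The joint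
  density factorises into normal densities with these variances, so the entropy gains are
  \<open>ln (2 \<pi> e \<sigma>\<^sup>2\<^sub>n) / 2\<close>. The variances decrease to a limit \<open>\<sigma>\<^sup>2\<close>, which is positive because the
  autocovariance, lowered by a small constant at lag 0, is still convex and hence positive semidefinite
  (Polya's criterion). Finiteness of the excess entropy thus amounts to summability of \<open>\<sigma>\<^sup>2\<^sub>n - \<sigma>\<^sup>2\<close>.

  By self-similarity the sums \<open>p\<close> and \<open>f\<close> of the \<open>N\<close> variables just before and just after a given
  time have a correlation \<open>2 powr (2 H - 1) - 1 > 0\<close> that does not depend on \<open>N\<close>. Expand \<open>f\<close> in the
  innovations \<open>u\<^sub>i\<close> of the future. Comparing one-step predictors with and without the extra
  regressor \<open>p\<close>, the squared covariance of \<open>u\<^sub>i\<close> and \<open>p\<close> is at most \<open>\<sigma>\<^sup>2\<^sub>i - \<sigma>\<^sup>2\<close> times the variance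
  of \<open>p\<close>. If these differences were summable, the terms with large \<open>i\<close> would contribute little to the
  correlation of \<open>f\<close> and \<open>p\<close>, uniformly in \<open>N\<close>, while each fixed \<open>u\<^sub>i\<close> is asymptotically
  uncorrelated with \<open>f\<close>; so the correlation would tend to 0.
\<close>

section \<open>Convexity and positive definiteness\<close>

fun fdiff :: "nat \<Rightarrow> real \<Rightarrow> real \<Rightarrow> real" where
  "fdiff 0 x t = t powr x"
| "fdiff (Suc n) x t = fdiff n x (t + 1) - fdiff n x t"

lemma fdiff_deriv:
  "t > 0 \<Longrightarrow> (fdiff n x has_real_derivative x * fdiff n (x - 1) t) (at t)"
proof (induction n arbitrary: t)
  case 0
  have "((\<lambda>t. t powr x) has_real_derivative x * t powr (x - 1)) (at t)"
    using 0 by (auto intro!: derivative_eq_intros)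
  then show ?case by simp
next
  case (Suc n)
  have "((\<lambda>t. fdiff n x (t + 1)) has_real_derivative x * fdiff n (x - 1) (t + 1)) (at t)"
    using Suc.IH[of "t + 1"] Suc.prems by (simp add: DERIV_shift)
  from DERIV_diff[OF this Suc.IH[OF Suc.prems]]
  show ?case by (simp add: algebra_simps)
qed

lemma continuous_on_fdiff: "x > 0 \<Longrightarrow> continuous_on {0..} (fdiff n x)"
proof (induction n)
  case 0
  have "continuous_on {0..} (\<lambda>t. t powr x)"
    by (rule continuous_on_powr') (use 0 in \<open>auto intro: continuous_intros\<close>)
  then show ?case by simp
next
  case (Suc n)
  have "continuous_on {0..} (\<lambda>t. fdiff n x (t + 1))"
    by (rule continuous_on_compose2[OF Suc.IH[OF Suc.prems]]) (auto intro!: continuous_intros)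
  then show ?case using Suc by (auto intro!: continuous_intros)
qed

text \<open>The mean value theorem on \<open>[t, t + 1]\<close> trades one difference for one
  derivative. At the left endpoint it asks for continuity only, so \<open>t = 0\<close> is
  admissible for \<open>x > 0\<close>.\<close>

lemma fdiff_Suc_mvt:
  assumes "t > 0 \<or> (t = 0 \<and> x > 0)"
  shows "\<exists>s>t. fdiff (Suc n) x t = x * fdiff n (x - 1) s"
proof -
  have "continuous_on {t..t+1} (fdiff n x)"
  proof (cases "t > 0")
    case True
    show ?thesis
      by (rule DERIV_continuous_on[where D = "\<lambda>u. x * fdiff n (x - 1) u"])
         (use True in \<open>auto intro!: DERIV_subset[OF fdiff_deriv]\<close>)
  next
    case False
    then show ?thesis
      using assms continuous_on_subset[OF continuous_on_fdiff, of x "{t..t+1}"] by auto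
  qed
  moreover have "fdiff n x differentiable at u" if "t < u" "u < t + 1" for u
    using fdiff_deriv[of u n x] that assms real_differentiable_def by fastforce
  ultimately obtain l z where z: "t < z" "z < t + 1" "(fdiff n x has_real_derivative l) (at z)"
    "fdiff n x (t + 1) - fdiff n x t = (t + 1 - t) * l"
    using MVT[of t "t + 1" "fdiff n x"] by auto
  have "z > 0" using z assms by auto
  with z(3) have "l = x * fdiff n (x - 1) z"
    by (intro DERIV_unique[OF _ fdiff_deriv])
  with z show ?thesis by (intro exI[of _ z]) simp
qed

text \<open>Each mean value step lowers the exponent by one, and the factors collect to a falling
  factorial; the \<open>n\<close>-th difference therefore has the sign of the \<open>n\<close>-th
  derivative.\<close>

lemma fdiff_sign:
  "s > 0 \<Longrightarrow> \<exists>u>0. fdiff n y s = (\<Prod>i<n. y - real i) * u"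
proof (induction n arbitrary: y s)
  case 0
  then show ?case by (intro exI[of _ "s powr y"]) simp
next
  case (Suc n)
  from fdiff_Suc_mvt[OF disjI1[OF Suc.prems], of n y]
  obtain s' where s': "s' > s" "fdiff (Suc n) y s = y * fdiff n (y - 1) s'" by blast
  with Suc.prems have "s' > 0" by simp
  from Suc.IH[OF \<open>s' > 0\<close>, of "y - 1"] obtain u where
    u: "u > 0" "fdiff n (y - 1) s' = (\<Prod>i<n. (y - 1) - real i) * u"
    by blast
  have "fdiff (Suc n) y s = (\<Prod>i<Suc n. y - real i) * u"
    unfolding s'(2) u(2) by (subst prod.lessThan_Suc_shift) (simp add: algebra_simps)
  with u(1) show ?case by blast
qed

lemma fdiff_sign0:
  assumes "t \<ge> 0" "x > 0"
  shows "\<exists>u>0. fdiff (Suc n) x t = (\<Prod>i<Suc n. x - real i) * u"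
proof -
  have "t > 0 \<or> (t = 0 \<and> x > 0)" using assms by auto
  from fdiff_Suc_mvt[OF this, of n]
  obtain s' where s': "s' > t" "fdiff (Suc n) x t = x * fdiff n (x - 1) s'" by blast
  with assms have "s' > 0" by simp
  from fdiff_sign[OF \<open>s' > 0\<close>, of n "x - 1"] obtain u where
    u: "u > 0" "fdiff n (x - 1) s' = (\<Prod>i<n. (x - 1) - real i) * u" by blast
  have "fdiff (Suc n) x t = (\<Prod>i<Suc n. x - real i) * u"
    unfolding s'(2) u(2) by (subst prod.lessThan_Suc_shift) (simp add: algebra_simps)
  with u(1) show ?thesis by blast
qed

text \<open>For \<open>1 < x < 2\<close> the falling factorial collects the positive factors
  \<open>x\<close> and \<open>x - 1\<close>, then the negative \<open>x - 2\<close> and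
  \<open>x - 3\<close>. The three signs become nonnegativity, monotonicity and convexity of the
  autocovariance from lag 1 on.\<close>

lemma fdiff_signs:
  assumes "1 < x" "x < 2" "t \<ge> 0"
  shows "fdiff 2 x t \<ge> 0" "fdiff 3 x t \<le> 0" "fdiff 4 x t \<ge> 0"
proof -
  have sign: "\<exists>u>0. fdiff (Suc n) x t = (\<Prod>i<Suc n. x - real i) * u" for n
    using fdiff_sign0 assms by simp
  show "fdiff 2 x t \<ge> 0" "fdiff 3 x t \<le> 0" "fdiff 4 x t \<ge> 0"
    using sign[of 1] sign[of 2] sign[of 3] assms
    by (auto simp: numeral_eq_Suc mult_le_0_iff zero_le_mult_iff simp del: fdiff.simps)
qed

lemma fdiff_3_eq: "fdiff 3 x t = fdiff 2 x (t + 1) - fdiff 2 x t"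
  using fdiff.simps(2)[of 2 x t] by simp

lemma fdiff_4_eq: "fdiff 4 x t = fdiff 2 x (t + 2) - 2 * fdiff 2 x (t + 1) + fdiff 2 x t"
  using fdiff.simps(2)[of 3 x t] by (simp add: fdiff_3_eq add.commute)

text \<open>With \<open>x = 2 * H\<close> this is twice the second difference of the autocovariance
  at lag 1, which involves lag 0 and is out of reach of \<open>fdiff_signs\<close>. It vanishes at
  \<open>x = 2\<close> and is strictly decreasing before that.\<close>

lemma powr_2_3_pos:
  assumes "1 < x" "x < (2::real)"
  shows "7 - 4 * 2 powr x + 3 powr x > 0"
proof -
  let ?q = "\<lambda>x::real. 7 - 4 * 2 powr x + 3 powr x"
  have d: "(?q has_real_derivative (3 powr y * ln 3 - 4 * (2 powr y * ln 2))) (at y)" for y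
    by (auto intro!: derivative_eq_intros)
  \<comment> \<open>Since \<open>(3/2) powr y <= 9/4\<close>, the claim reduces to
    \<open>9 * ln 3 < 16 * ln 2\<close>, which follows from \<open>3 ^ 9 < 2 ^ 16\<close>.\<close>
  have neg: "3 powr y * ln 3 - 4 * (2 powr y * ln 2) < 0" if "y < 2" for y :: real
  proof -
    have l3: "9 * ln 3 < (16 * ln 2 :: real)"
    proof -
      have "ln (3 ^ 9 :: real) < ln (2 ^ 16)" by (subst ln_less_cancel_iff) auto
      moreover have "ln (3 ^ 9 :: real) = 9 * ln 3" "ln (2 ^ 16 :: real) = 16 * ln 2"
        by (subst ln_realpow; simp)+
      ultimately show ?thesis by linarith
    qed
    have "(3/2) powr y \<le> (3/2) powr (2::real)" using that by (intro powr_mono) auto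
    then have "3 powr y \<le> 9/4 * 2 powr y" by (simp add: powr_divide field_simps)
    then have "3 powr y * ln 3 \<le> 9/4 * 2 powr y * ln 3" by (intro mult_right_mono) auto
    also have "\<dots> = 2 powr y / 4 * (9 * ln 3)" by simp
    also have "\<dots> < 2 powr y / 4 * (16 * ln 2)" using l3 by (intro mult_strict_left_mono) auto
    finally show ?thesis by (simp add: mult_ac)
  qed
  obtain z where "x < z" "z < 2" "?q 2 - ?q x = (2 - x) * (3 powr z * ln 3 - 4 * (2 powr z * ln 2))"
    using MVT2[OF assms(2) d] by blast
  with neg[of z] have "?q 2 - ?q x < 0" using assms by (simp add: mult_pos_neg)
  then show ?thesis by simp
qed

section \<open>Positive semidefinite kernels from convex sequences\<close>

lemma sum_swap3:
  "(\<Sum>i\<in>I. \<Sum>j\<in>J. \<Sum>m\<in>A. F i j m) = (\<Sum>m\<in>A. \<Sum>i\<in>I. \<Sum>j\<in>J. F i j m)"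
proof -
  have "(\<Sum>i\<in>I. \<Sum>j\<in>J. \<Sum>m\<in>A. F i j m) = (\<Sum>i\<in>I. \<Sum>m\<in>A. \<Sum>j\<in>J. F i j m)"
    by (intro sum.cong refl sum.swap)
  also have "\<dots> = (\<Sum>m\<in>A. \<Sum>i\<in>I. \<Sum>j\<in>J. F i j m)" by (rule sum.swap)
  finally show ?thesis .
qed

text \<open>The kernel counts the integers common to the windows \<open>[i, i + m)\<close> and
  \<open>[j, j + m)\<close>, truncated subtraction giving 0 for disjoint ones. It is a Gram matrix
  of window indicators, so the form is a sum of squares.\<close>

lemma triangle_kernel_psd:
  fixes c :: "nat \<Rightarrow> real"
  shows "0 \<le> (\<Sum>i<n. \<Sum>j<n. c i * c j * real (m - nat \<bar>int i - int j\<bar>))"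
proof -
  have k: "real (m - nat \<bar>int i - int j\<bar>) =
      (\<Sum>t<n+m. of_bool (i \<le> t \<and> t < i + m) * of_bool (j \<le> t \<and> t < j + m))"
    if "i < n" "j < n" for i j
  proof -
    have "(\<Sum>t<n+m. of_bool (i \<le> t \<and> t < i + m) * of_bool (j \<le> t \<and> t < j + m)) =
        (\<Sum>t\<in>{max i j..<min i j + m}. 1 :: real)"
      using that by (intro sum.mono_neutral_cong_right) auto
    also have "\<dots> = real (m - nat \<bar>int i - int j\<bar>)"
      by (auto simp: max_def min_def)
    finally show ?thesis ..
  qed
  have "(\<Sum>i<n. \<Sum>j<n. c i * c j * real (m - nat \<bar>int i - int j\<bar>)) =
      (\<Sum>i<n. \<Sum>j<n. \<Sum>t<n+m. (c i * of_bool (i \<le> t \<and> t < i + m)) * (c j * of_bool (j \<le> t \<and> t < j + m)))"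
    by (intro sum.cong refl) (simp only: k lessThan_iff sum_distrib_left mult_ac)
  also have "\<dots> = (\<Sum>i<n. \<Sum>t<n+m. \<Sum>j<n. (c i * of_bool (i \<le> t \<and> t < i + m)) * (c j * of_bool (j \<le> t \<and> t < j + m)))"
    by (intro sum.cong refl sum.swap)
  also have "\<dots> = (\<Sum>t<n+m. (\<Sum>i<n. c i * of_bool (i \<le> t \<and> t < i + m))\<^sup>2)"
    by (subst sum.swap) (simp only: power2_eq_square sum_product)
  also have "\<dots> \<ge> 0" by (intro sum_nonneg) auto
  finally show ?thesis .
qed

text \<open>A discrete Taylor expansion about the far end \<open>Suc N\<close>: second differences
  are the weights of triangles, and truncated subtraction discards those with
  \<open>m <= k\<close>.\<close>

lemma convex_sequence_triangles:
  fixes a :: "nat \<Rightarrow> real"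
  assumes "k \<le> Suc N"
  shows "a k = a (Suc N) + (a N - a (Suc N)) * real (Suc N - k) +
    (\<Sum>m=1..N. (a (m - 1) - 2 * a m + a (Suc m)) * real (m - k))"
  using assms
proof (induction N)
  case 0
  then show ?case by (cases k) auto
next
  case (Suc N)
  show ?case
  proof (cases "k = Suc (Suc N)")
    case True
    then show ?thesis by simp
  next
    case False
    with Suc.prems have le: "k \<le> Suc N" by simp
    have e: "real (Suc (Suc N) - k) = real (Suc N - k) + 1" using le by (simp add: Suc_diff_le)
    show ?thesis
      by (subst Suc.IH[OF le]) (use le in \<open>simp add: e algebra_simps\<close>)
  qed
qed

text \<open>The hypotheses make every weight in \<open>convex_sequence_triangles\<close>
  nonnegative, so the kernel is a nonnegative combination of constant and triangular
  kernels.\<close>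

lemma polya_psd:
  fixes a :: "nat \<Rightarrow> real"
  assumes conv: "\<And>m. 1 \<le> m \<Longrightarrow> m \<le> n \<Longrightarrow> 0 \<le> a (m - 1) - 2 * a m + a (Suc m)"
    and dec: "a (Suc n) \<le> a n" and nn: "0 \<le> a (Suc n)"
  shows "0 \<le> (\<Sum>i<n. \<Sum>j<n. c i * c j * a (nat \<bar>int i - int j\<bar>))"
proof -
  let ?d = "\<lambda>i j. nat \<bar>int i - int j\<bar>"
  have "(\<Sum>i<n. \<Sum>j<n. c i * c j * a (?d i j)) =
     (\<Sum>i<n. \<Sum>j<n. a (Suc n) * (c i * c j) + (a n - a (Suc n)) * (c i * c j * real (Suc n - ?d i j)) +
      (\<Sum>m=1..n. (a (m - 1) - 2 * a m + a (Suc m)) * (c i * c j * real (m - ?d i j))))"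
  proof (intro sum.cong refl)
    fix i j assume "i \<in> {..<n}" "j \<in> {..<n}"
    then have "?d i j \<le> Suc n" by auto
    from arg_cong[OF convex_sequence_triangles[OF this, of a], of "\<lambda>z. c i * c j * z"] show "c i * c j * a (?d i j) =
      a (Suc n) * (c i * c j) + (a n - a (Suc n)) * (c i * c j * real (Suc n - ?d i j)) +
      (\<Sum>m=1..n. (a (m - 1) - 2 * a m + a (Suc m)) * (c i * c j * real (m - ?d i j)))"
      by (simp only: distrib_left sum_distrib_left mult_ac)
  qed
  also have "\<dots> = a (Suc n) * (\<Sum>i<n. \<Sum>j<n. c i * c j)
     + (a n - a (Suc n)) * (\<Sum>i<n. \<Sum>j<n. c i * c j * real (Suc n - ?d i j))
     + (\<Sum>i<n. \<Sum>j<n. \<Sum>m=1..n. (a (m - 1) - 2 * a m + a (Suc m)) * (c i * c j * real (m - ?d i j)))"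
    by (simp add: sum.distrib sum_distrib_left)
  also have "(\<Sum>i<n. \<Sum>j<n. \<Sum>m=1..n. (a (m - 1) - 2 * a m + a (Suc m)) * (c i * c j * real (m - ?d i j)))
     = (\<Sum>m=1..n. (a (m - 1) - 2 * a m + a (Suc m)) * (\<Sum>i<n. \<Sum>j<n. c i * c j * real (m - ?d i j)))"
    by (subst sum_swap3) (simp only: sum_distrib_left)
  finally have eq: "(\<Sum>i<n. \<Sum>j<n. c i * c j * a (?d i j)) =
     a (Suc n) * (\<Sum>i<n. \<Sum>j<n. c i * c j)
     + (a n - a (Suc n)) * (\<Sum>i<n. \<Sum>j<n. c i * c j * real (Suc n - ?d i j))
     + (\<Sum>m=1..n. (a (m - 1) - 2 * a m + a (Suc m)) * (\<Sum>i<n. \<Sum>j<n. c i * c j * real (m - ?d i j)))" .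
  have sq: "(\<Sum>i<n. \<Sum>j<n. c i * c j) = (\<Sum>i<n. c i)\<^sup>2"
    by (simp add: power2_eq_square sum_product)
  have "0 \<le> a (Suc n) * (\<Sum>i<n. c i)\<^sup>2" using nn by simp
  moreover have "0 \<le> (a n - a (Suc n)) * (\<Sum>i<n. \<Sum>j<n. c i * c j * real (Suc n - ?d i j))"
    using dec by (intro mult_nonneg_nonneg triangle_kernel_psd) simp
  moreover have "0 \<le> (\<Sum>m=1..n. (a (m - 1) - 2 * a m + a (Suc m)) *
      (\<Sum>i<n. \<Sum>j<n. c i * c j * real (m - ?d i j)))"
    by (intro sum_nonneg mult_nonneg_nonneg triangle_kernel_psd conv) simp_all
  ultimately show ?thesis unfolding eq sq by linarith
qed

section \<open>Innovations of a Toeplitz form\<close>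

lemma sum_lessThan_add:
  "(\<Sum>i<N + n. g i) = (\<Sum>i<N. g i) + (\<Sum>i<n. g (N + i))" for n :: nat
  by (induction n) (simp_all add: add_ac)

text \<open>\<open>r\<close> stands for the autocovariance of a stationary sequence. A single
  \<open>\<delta>\<close> serves all sizes \<open>n\<close>; it keeps the prediction errors bounded
  away from 0.\<close>

locale toeplitz_form =
  fixes r :: "int \<Rightarrow> real" and \<delta> :: real
  assumes even: "r (- k) = r k"
    and delta_pos: "0 < \<delta>"
    and coercive: "\<delta> * (\<Sum>i<n. (c i)\<^sup>2) \<le> (\<Sum>i<n. \<Sum>j<n. c i * c j * r (int i - int j))"
begin

text \<open>The covariance of two linear combinations of the first \<open>L\<close> variables.
  Coefficients are total functions, so vectors of different lengths can be compared through
  \<open>form_restrict\<close>.\<close>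

definition form :: "nat \<Rightarrow> (nat \<Rightarrow> real) \<Rightarrow> (nat \<Rightarrow> real) \<Rightarrow> real" where
  "form L c d = (\<Sum>i<L. \<Sum>j<L. c i * d j * r (int i - int j))"

lemma form_commute: "form L c d = form L d c"
  unfolding form_def
  by (subst sum.swap, intro sum.cong refl)
     (metis even minus_diff_eq mult.commute)

lemma form_by_columns: "form L c d = (\<Sum>j<L. d j * (\<Sum>i<L. c i * r (int i - int j)))"
  unfolding form_def by (subst sum.swap) (simp add: sum_distrib_left mult_ac)

lemma form_add_left: "form L (\<lambda>i. c i + c' i) d = form L c d + form L c' d"
  unfolding form_def by (simp add: algebra_simps sum.distrib)

lemma form_scale_left: "form L (\<lambda>i. z * c i) d = z * form L c d"
  unfolding form_def by (simp add: algebra_simps sum_distrib_left)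

lemma form_sum_left: "form L (\<lambda>k. \<Sum>i\<in>A. a i * w i k) d = (\<Sum>i\<in>A. a i * form L (w i) d)"
proof -
  have "form L (\<lambda>k. \<Sum>i\<in>A. a i * w i k) d =
     (\<Sum>k<L. \<Sum>j<L. \<Sum>i\<in>A. a i * (w i k * d j * r (int k - int j)))"
    unfolding form_def by (simp add: sum_distrib_left sum_distrib_right mult_ac)
  also have "\<dots> = (\<Sum>i\<in>A. a i * form L (w i) d)"
    unfolding form_def by (subst sum_swap3) (simp add: sum_distrib_left)
  finally show ?thesis .
qed

lemma form_add_square:
  "form L (\<lambda>i. c i + z * d i) (\<lambda>i. c i + z * d i) = form L c c + 2 * z * form L c d + z\<^sup>2 * form L d d"
proof -
  have "form L (\<lambda>i. c i + z * d i) e = form L c e + z * form L d e" for e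
    by (simp add: form_add_left form_scale_left)
  moreover have "form L e (\<lambda>i. c i + z * d i) = form L e c + z * form L e d" for e
    by (simp add: form_commute[of L e] form_add_left form_scale_left)
  ultimately show ?thesis
    by (simp add: form_commute[of L d c] algebra_simps power2_eq_square)
qed

lemma form_restrict:
  assumes "n \<le> L" "\<And>i. n \<le> i \<Longrightarrow> c i = 0" "\<And>i. n \<le> i \<Longrightarrow> d i = 0"
  shows "form L c d = form n c d"
proof -
  obtain m where L: "L = n + m" using assms(1) le_Suc_ex by blast
  show ?thesis unfolding form_def L using assms by (simp add: sum_lessThan_add)
qed

lemma form_cong:
  "(\<And>i. i < L \<Longrightarrow> c i = c' i) \<Longrightarrow> (\<And>i. i < L \<Longrightarrow> d i = d' i) \<Longrightarrow> form L c d = form L c' d'"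
  unfolding form_def by (intro sum.cong) auto

text \<open>Translation in time; \<open>form_shift\<close> expresses stationarity.\<close>

definition shift :: "nat \<Rightarrow> (nat \<Rightarrow> real) \<Rightarrow> nat \<Rightarrow> real" where
  "shift N c k = (if k < N then 0 else c (k - N))"

lemma form_shift: "form (N + n) (shift N c) (shift N d) = form n c d"
  unfolding form_def by (simp add: sum_lessThan_add shift_def)

lemma form_ge: "\<delta> * (\<Sum>i<L. (c i)\<^sup>2) \<le> form L c c"
  unfolding form_def by (rule coercive)

lemma form_nonneg: "0 \<le> form L c c"
  using form_ge[of c L] delta_pos
  by (meson less_eq_real_def mult_nonneg_nonneg order_trans sum_nonneg zero_le_power2)

lemma form_ge_component: "i < L \<Longrightarrow> \<delta> * (c i)\<^sup>2 \<le> form L c c"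
proof -
  assume "i < L"
  then have "(c i)\<^sup>2 \<le> (\<Sum>i<L. (c i)\<^sup>2)" by (intro member_le_sum) auto
  then have "\<delta> * (c i)\<^sup>2 \<le> \<delta> * (\<Sum>i<L. (c i)\<^sup>2)" using delta_pos by simp
  with form_ge[of c L] show ?thesis by linarith
qed

text \<open>Induction by bordering. The vector \<open>b\<close> is the new variable minus its
  prediction, orthogonal to the first \<open>n\<close> variables, so adding a multiple of it repairs
  the last equation without disturbing the others. Coercivity makes the pivot \<open>s\<close> at
  least \<open>\<delta>\<close>.\<close>

lemma normal_equations_solvable:
  "\<exists>c. \<forall>k<n. (\<Sum>i<n. c i * r (int i - int k)) = y k"
proof (induction n arbitrary: y)
  case 0
  then show ?case by simp
next
  case (Suc n)
  obtain c where c: "\<And>k. k < n \<Longrightarrow> (\<Sum>i<n. c i * r (int i - int k)) = r (int n - int k)"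
    using Suc.IH[of "\<lambda>k. r (int n - int k)"] by auto
  obtain c' where c': "\<And>k. k < n \<Longrightarrow> (\<Sum>i<n. c' i * r (int i - int k)) = y k"
    using Suc.IH[of y] by auto
  define b where "b i = (if i = n then 1 else - c i)" for i
  define s where "s = (\<Sum>i<Suc n. b i * r (int i - int n))"
  have b: "(\<Sum>i<Suc n. b i * r (int i - int k)) = 0" if "k < n" for k
  proof -
    have "(\<Sum>i<n. b i * r (int i - int k)) = (\<Sum>i<n. - (c i * r (int i - int k)))"
      by (intro sum.cong) (auto simp: b_def)
    then show ?thesis using c[OF that] by (simp add: b_def sum_negf)
  qed
  have "form (Suc n) b b = s"
    unfolding form_by_columns using b by (simp add: s_def b_def)
  with form_ge_component[of n "Suc n" b] have "\<delta> \<le> s" by (simp add: b_def)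
  then have "s \<noteq> 0" using delta_pos by linarith
  define z where "z = (y n - (\<Sum>i<n. c' i * r (int i - int n))) / s"
  have "(\<Sum>i<Suc n. ((if i < n then c' i else 0) + z * b i) * r (int i - int k)) = y k" if "k < Suc n" for k
  proof -
    have "(\<Sum>i<Suc n. ((if i < n then c' i else 0) + z * b i) * r (int i - int k)) =
       (\<Sum>i<Suc n. (if i < n then c' i else 0) * r (int i - int k)) + z * (\<Sum>i<Suc n. b i * r (int i - int k))"
      by (simp only: distrib_right sum.distrib sum_distrib_left mult.assoc)
    also have "(\<Sum>i<Suc n. (if i < n then c' i else 0) * r (int i - int k)) = (\<Sum>i<n. c' i * r (int i - int k))"
      by simp
    also have "\<dots> + z * (\<Sum>i<Suc n. b i * r (int i - int k)) = y k"
    proof (cases "k = n")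
      case True
      then show ?thesis using \<open>s \<noteq> 0\<close> by (simp only: s_def[symmetric] z_def) simp
    next
      case False
      with that have "k < n" by simp
      then show ?thesis using b[of k] c'[of k] by simp
    qed
    finally show ?thesis .
  qed
  then show ?case by (intro exI allI impI)
qed

section \<open>Linear prediction and innovation variances\<close>

definition predictor :: "nat \<Rightarrow> nat \<Rightarrow> real" where
  "predictor n = (SOME c. \<forall>k<n. (\<Sum>i<n. c i * r (int i - int k)) = r (int n - int k))"

text \<open>Coefficients of the one-step prediction error. The entries of \<open>predictor n\<close>
  from index \<open>n\<close> on are arbitrary values of the choice operator and are masked
  here.\<close>

definition innov :: "nat \<Rightarrow> nat \<Rightarrow> real" where
  "innov n i = (if i = n then 1 else if i < n then - predictor n i else 0)"

definition innov_var :: "nat \<Rightarrow> real" where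
  "innov_var n = form (Suc n) (innov n) (innov n)"

lemma predictor: "k < n \<Longrightarrow> (\<Sum>i<n. predictor n i * r (int i - int k)) = r (int n - int k)"
  unfolding predictor_def using someI_ex[OF normal_equations_solvable[of n "\<lambda>k. r (int n - int k)"]] by blast

lemma innov_simps: "innov n n = 1" "i > n \<Longrightarrow> innov n i = 0"
  by (simp_all add: innov_def)

lemma innov_orth:
  assumes "k < n" "n < L"
  shows "(\<Sum>i<L. innov n i * r (int i - int k)) = 0"
proof -
  obtain m where L: "L = Suc n + m" using assms(2) less_imp_Suc_add by fastforce
  have "(\<Sum>i<n. innov n i * r (int i - int k)) = (\<Sum>i<n. - (predictor n i * r (int i - int k)))"
    by (intro sum.cong) (auto simp: innov_def)
  then show ?thesis unfolding L sum_lessThan_add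
    using predictor[OF assms(1)] by (simp add: innov_simps sum_negf)
qed

lemma form_innov_left:
  assumes "n < L" "\<And>j. n \<le> j \<Longrightarrow> d j = 0"
  shows "form L (innov n) d = 0"
  unfolding form_by_columns
proof (intro sum.neutral ballI)
  fix j assume "j \<in> {..<L}"
  show "d j * (\<Sum>i<L. innov n i * r (int i - int j)) = 0"
    using assms innov_orth[of j n L] by (cases "j < n") auto
qed

lemma form_innov_self: "n < L \<Longrightarrow> form L (innov n) (innov n) = innov_var n"
  unfolding innov_var_def by (rule form_restrict) (auto simp: innov_simps)

lemma form_innov_innov:
  assumes "i < L" "j < L"
  shows "form L (innov i) (innov j) = (if i = j then innov_var i else 0)"
proof (cases i j rule: linorder_cases)
  case less
  then have "form L (innov j) (innov i) = 0"
    using assms by (intro form_innov_left) (auto simp: innov_simps)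
  with less show ?thesis by (simp add: form_commute[of L "innov i"])
next
  case equal
  with assms show ?thesis by (simp add: form_innov_self)
next
  case greater
  then have "form L (innov i) (innov j) = 0"
    using assms by (intro form_innov_left) (auto simp: innov_simps)
  with greater show ?thesis by simp
qed

text \<open>Least-squares optimality: a competitor with the same leading coefficient differs from
  the innovation by a combination of past variables, which is orthogonal to the innovation, and
  Pythagoras applies.\<close>

lemma innov_var_le:
  assumes "n < L" "v n = 1" "\<And>i. n < i \<Longrightarrow> v i = 0"
  shows "innov_var n \<le> form L v v"
proof -
  define d where "d i = v i - innov n i" for i
  have d0: "d j = 0" if "n \<le> j" for j
    using that assms by (cases "j = n") (auto simp: d_def innov_simps)
  have "form L v v = form L (\<lambda>i. innov n i + 1 * d i) (\<lambda>i. innov n i + 1 * d i)"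
    by (simp add: d_def)
  also have "\<dots> = innov_var n + form L d d"
    unfolding form_add_square using assms(1) d0 by (simp add: form_innov_left form_innov_self)
  finally show ?thesis using form_nonneg[of L d] by linarith
qed

lemma innov_var_ge: "\<delta> \<le> innov_var n"
  using form_ge_component[of n "Suc n" "innov n"] by (simp add: innov_var_def innov_simps)

text \<open>A longer past cannot hurt: by stationarity the shifted innovation is a competitor, of
  unchanged variance, for predicting the variable \<open>N + n\<close>.\<close>

lemma innov_var_add_le: "innov_var (N + n) \<le> innov_var n"
  using innov_var_le[of "N + n" "N + Suc n" "shift N (innov n)"]
  unfolding form_shift by (simp add: innov_var_def shift_def innov_simps)

lemma decseq_innov_var: "decseq innov_var"
  using innov_var_add_le[of 1] by (intro decseq_SucI) simp

lemma convergent_innov_var: "convergent innov_var"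
  using decseq_convergent[OF decseq_innov_var, of \<delta>] innov_var_ge unfolding convergent_def by metis

lemma lim_innov_var: "innov_var \<longlonglongrightarrow> lim innov_var"
  using convergent_innov_var by (simp add: convergent_LIMSEQ_iff)

lemma lim_innov_var_le: "lim innov_var \<le> innov_var n"
  using decseq_ge[OF decseq_innov_var lim_innov_var] .

lemma lim_innov_var_ge: "\<delta> \<le> lim innov_var"
  using LIMSEQ_le_const[OF lim_innov_var] innov_var_ge by blast

text \<open>The innovations form a unit triangular system, so the top coefficient can be peeled
  off.\<close>

lemma innov_basis: "\<exists>a. \<forall>k<n. c k = (\<Sum>i<n. a i * innov i k)"
proof (induction n arbitrary: c)
  case 0
  show ?case by (intro exI allI impI) simp
next
  case (Suc n)
  from Suc.IH[of "\<lambda>k. c k - c n * innov n k"]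
  obtain a where a: "\<forall>k<n. c k - c n * innov n k = (\<Sum>i<n. a i * innov i k)" ..
  have "c k = (\<Sum>i<Suc n. (a(n := c n)) i * innov i k)" if "k < Suc n" for k
  proof (cases "k = n")
    case True
    then show ?thesis by (simp add: innov_simps)
  next
    case False
    with that have "k < n" by simp
    have "(\<Sum>i<Suc n. (a(n := c n)) i * innov i k) = (\<Sum>i<n. a i * innov i k) + c n * innov n k"
      by simp
    with a \<open>k < n\<close> show ?thesis by (metis add.commute diff_add_cancel)
  qed
  then show ?case by (intro exI[of _ "a(n := c n)"]) blast
qed

text \<open>
  Perturbing the shifted innovation by a multiple of \<open>p\<close>, which lies in its past, still yields a
  competitor for the prediction of the variable \<open>N + i\<close>; optimise over the multiple.
\<close>

lemma innov_form_sq_le: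
  assumes "i < n" "0 < form (N + n) p p" "\<And>k. N \<le> k \<Longrightarrow> p k = 0"
  shows "(form (N + n) (shift N (innov i)) p)\<^sup>2 \<le> form (N + n) p p * (innov_var i - lim innov_var)"
proof -
  let ?V = "form (N + n) p p" and ?g = "form (N + n) (shift N (innov i)) p"
  define z where "z = - ?g / ?V"
  let ?w = "\<lambda>k. shift N (innov i) k + z * p k"
  have "lim innov_var \<le> innov_var (N + i)" by (rule lim_innov_var_le)
  also have "\<dots> \<le> form (N + n) ?w ?w"
    using assms by (intro innov_var_le) (auto simp: shift_def innov_simps)
  also have "\<dots> = innov_var i + 2 * z * ?g + z\<^sup>2 * ?V"
    unfolding form_add_square form_shift using form_innov_self[OF assms(1)] by simp
  also have "\<dots> = innov_var i - ?g\<^sup>2 / ?V"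
    using assms(2) by (simp add: z_def power2_eq_square field_simps)
  finally show ?thesis using assms(2) by (simp add: field_simps)
qed

text \<open>The left side is the covariance of two adjacent block sums. It is expanded in the
  innovations of the later block and split at index \<open>m\<close>: early terms are bounded by the
  covariances of these innovations with their own block sum, late ones by the tail of the innovation
  variances.\<close>

lemma past_future_bound:
  fixes V :: "nat \<Rightarrow> real"
  assumes summ: "summable (\<lambda>i. innov_var i - lim innov_var)"
    and mN: "m \<le> N" and N: "0 < N"
    and V: "V N = (\<Sum>i<N. \<Sum>j<N. r (int i - int j))"
  shows "(\<Sum>i<N. \<Sum>j<N. r (int (N + i) - int j)) \<le>
    sqrt (V N) * (sqrt (innov_var 0) / \<delta>) * (\<Sum>i<m. \<bar>\<Sum>j<Suc i. innov i j * (\<Sum>k<N. r (int k - int j))\<bar>)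
    + V N * sqrt ((\<Sum>i. innov_var (i + m) - lim innov_var) / \<delta>)"
proof -
  define T where "T = (\<Sum>i. innov_var (i + m) - lim innov_var)"
  define y where "y i = (\<Sum>j<Suc i. innov i j * (\<Sum>k<N. r (int k - int j)))" for i
  let ?G = "form (N + N)"
  \<comment> \<open>\<open>p\<close> is the sum over the past block, and \<open>f\<close> the same
    sum moved to the future block.\<close>
  define p where "p k = (if k < N then 1 else 0 :: real)" for k
  define f where "f = shift N p"
  have V1: "V N = form N p p"
    unfolding form_def V by (intro sum.cong) (auto simp: p_def)
  have Vf: "?G f f = V N" by (simp add: V1 f_def form_shift)
  have Vp: "?G p p = V N" unfolding V1 by (rule form_restrict) (auto simp: p_def)
  have Vpos: "0 < V N"
    using form_ge_component[of 0 N p] N delta_pos by (simp add: V1 p_def)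
  have "?G f p = (\<Sum>i<N. \<Sum>j<N. r (int (N + i) - int j))"
    unfolding form_def sum_lessThan_add f_def shift_def p_def
    by (simp add: sum.lessThan_Suc cong: sum.cong_simp)
  note C = this
  \<comment> \<open>The \<open>a i\<close> are the coordinates of the block sum in the orthogonal
    system of innovations; \<open>g i\<close> is the covariance of the \<open>i\<close>-th future
    innovation with the past.\<close>
  from innov_basis[of N p] obtain a where a: "\<forall>k<N. p k = (\<Sum>i<N. a i * innov i k)" ..
  define g where "g i = ?G (shift N (innov i)) p" for i
  have f_exp: "?G f d = (\<Sum>i<N. a i * ?G (shift N (innov i)) d)" for d
  proof -
    have "?G f d = ?G (\<lambda>k. \<Sum>i<N. a i * shift N (innov i) k) d"
      using a by (intro form_cong) (auto simp: f_def shift_def)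
    then show ?thesis by (simp add: form_sum_left)
  qed
  have fu: "?G f (shift N (innov i)) = a i * innov_var i" if "i < N" for i
  proof -
    have "?G f (shift N (innov i)) = (\<Sum>j<N. a j * (if j = i then innov_var i else 0))"
      unfolding f_exp form_shift using that by (intro sum.cong refl) (simp add: form_innov_innov)
    then show ?thesis using that by (simp add: if_distrib cong: if_cong)
  qed
  have ay: "a i * innov_var i = y i" if "i < N" for i
  proof -
    have "a i * innov_var i = form N p (innov i)" using fu[OF that] by (simp add: f_def form_shift)
    also have "\<dots> = (\<Sum>j<N. innov i j * (\<Sum>k<N. r (int k - int j)))"
      unfolding form_by_columns by (intro sum.cong arg_cong2[where f = "(*)"] refl) (simp add: p_def)
    also have "\<dots> = y i"
      unfolding y_def using that by (intro sum.mono_neutral_right) (auto simp: innov_simps)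
    finally show ?thesis .
  qed
  have parseval: "V N = (\<Sum>i<N. (a i)\<^sup>2 * innov_var i)"
  proof -
    have "V N = (\<Sum>i<N. a i * ?G f (shift N (innov i)))"
      unfolding Vf[symmetric] by (subst f_exp) (simp add: form_commute)
    then show ?thesis by (simp add: fu power2_eq_square mult_ac)
  qed
  have g_sq: "(g i)\<^sup>2 \<le> V N * (innov_var i - lim innov_var)" if "i < N" for i
    using innov_form_sq_le[of i N N p] that Vpos unfolding Vp g_def by (auto simp: p_def)
  have pos: "0 < innov_var i" for i using innov_var_ge[of i] delta_pos by linarith
  \<comment> \<open>For early indices a crude bound is enough:
    \<open>innov_var i >= \<delta>\<close> controls \<open>a i\<close>, and \<open>g_sq\<close> with
    \<open>innov_var 0\<close> controls \<open>g i\<close>.\<close>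
  have term_bd: "a i * g i \<le> sqrt (V N) * (sqrt (innov_var 0) / \<delta>) * \<bar>y i\<bar>" if "i < N" for i
  proof -
    have "\<bar>a i\<bar> * \<delta> \<le> \<bar>a i\<bar> * innov_var i" using innov_var_ge by (intro mult_left_mono) auto
    also have "\<dots> = \<bar>y i\<bar>" using ay[OF that] pos[of i] by (metis abs_mult abs_of_pos)
    finally have ai: "\<bar>a i\<bar> \<le> \<bar>y i\<bar> / \<delta>" using delta_pos by (simp add: field_simps)
    have "(g i)\<^sup>2 \<le> V N * innov_var 0"
    proof -
      have "innov_var i - lim innov_var \<le> innov_var 0"
        using decseqD[OF decseq_innov_var, of 0 i] lim_innov_var_ge delta_pos by simp
      then have "V N * (innov_var i - lim innov_var) \<le> V N * innov_var 0"
        using Vpos by (intro mult_left_mono) auto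
      with g_sq[OF that] show ?thesis by linarith
    qed
    then have gi: "\<bar>g i\<bar> \<le> sqrt (V N) * sqrt (innov_var 0)"
      by (metis real_sqrt_abs real_sqrt_le_mono real_sqrt_mult)
    have "a i * g i \<le> \<bar>a i\<bar> * \<bar>g i\<bar>" by (metis abs_ge_self abs_mult)
    also have "\<dots> \<le> (\<bar>y i\<bar> / \<delta>) * (sqrt (V N) * sqrt (innov_var 0))"
      using ai gi delta_pos by (intro mult_mono) auto
    finally show ?thesis by (simp add: field_simps)
  qed
  \<comment> \<open>Cauchy-Schwarz after moving a factor \<open>sqrt (innov_var i)\<close> from one
    term to the other: the first sum becomes part of \<open>parseval\<close>, the second is
    controlled by \<open>g_sq\<close> and adds up to at most
    \<open>V N * (T / \<delta>)\<close>.\<close>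
  have tail: "(\<Sum>i\<in>{m..<N}. a i * g i) \<le> V N * sqrt (T / \<delta>)"
  proof -
    have "(\<Sum>i\<in>{m..<N}. a i * g i)\<^sup>2 =
      (\<Sum>i\<in>{m..<N}. (a i * sqrt (innov_var i)) * (g i / sqrt (innov_var i)))\<^sup>2"
      using pos by (intro arg_cong[where f = "\<lambda>z. z\<^sup>2"] sum.cong refl) (simp add: less_imp_neq[symmetric])
    also have "\<dots> \<le> (\<Sum>i\<in>{m..<N}. (a i * sqrt (innov_var i))\<^sup>2) * (\<Sum>i\<in>{m..<N}. (g i / sqrt (innov_var i))\<^sup>2)"
      by (rule Cauchy_Schwarz_ineq_sum)
    also have "\<dots> \<le> V N * (V N * (T / \<delta>))"
    proof (rule mult_mono)
      have "(\<Sum>i\<in>{m..<N}. (a i * sqrt (innov_var i))\<^sup>2) = (\<Sum>i\<in>{m..<N}. (a i)\<^sup>2 * innov_var i)"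
        using pos by (intro sum.cong refl) (simp add: power_mult_distrib less_imp_le)
      also have "\<dots> \<le> (\<Sum>i<N. (a i)\<^sup>2 * innov_var i)"
        by (rule sum_mono2) (auto simp: less_imp_le[OF pos])
      also have "\<dots> = V N" by (rule parseval[symmetric])
      finally show "(\<Sum>i\<in>{m..<N}. (a i * sqrt (innov_var i))\<^sup>2) \<le> V N" .
      have "(\<Sum>i\<in>{m..<N}. (g i / sqrt (innov_var i))\<^sup>2) \<le> (\<Sum>i\<in>{m..<N}. (V N / \<delta>) * (innov_var i - lim innov_var))"
      proof (rule sum_mono)
        fix i assume "i \<in> {m..<N}"
        then have gi: "(g i)\<^sup>2 \<le> V N * (innov_var i - lim innov_var)" using g_sq by simp
        have "(g i / sqrt (innov_var i))\<^sup>2 = (g i)\<^sup>2 / innov_var i"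
          using pos[of i] by (simp add: power_divide)
        also have "\<dots> \<le> (g i)\<^sup>2 / \<delta>" using innov_var_ge[of i] delta_pos by (intro divide_left_mono) auto
        also have "\<dots> \<le> V N * (innov_var i - lim innov_var) / \<delta>"
          using gi delta_pos by (intro divide_right_mono) auto
        finally show "(g i / sqrt (innov_var i))\<^sup>2 \<le> (V N / \<delta>) * (innov_var i - lim innov_var)" by simp
      qed
      also have "\<dots> = (V N / \<delta>) * (\<Sum>i\<in>{m..<N}. innov_var i - lim innov_var)" by (simp add: sum_distrib_left)
      also have "\<dots> \<le> (V N / \<delta>) * T"
      proof (rule mult_left_mono)
        have "(\<Sum>i\<in>{0 + m..<N - m + m}. innov_var i - lim innov_var) =
            (\<Sum>i\<in>{0..<N - m}. innov_var (i + m) - lim innov_var)"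
          by (rule sum.shift_bounds_nat_ivl)
        then have "(\<Sum>i\<in>{m..<N}. innov_var i - lim innov_var) =
            (\<Sum>i<N - m. innov_var (i + m) - lim innov_var)"
          using mN by (simp add: lessThan_atLeast0)
        also have "\<dots> \<le> T" unfolding T_def
        proof (rule sum_le_suminf)
          show "summable (\<lambda>i. innov_var (i + m) - lim innov_var)"
            using summ by (rule summable_ignore_initial_segment)
        qed (simp_all add: lim_innov_var_le)
        finally show "(\<Sum>i\<in>{m..<N}. innov_var i - lim innov_var) \<le> T" .
      qed (use Vpos delta_pos in simp)
      finally show "(\<Sum>i\<in>{m..<N}. (g i / sqrt (innov_var i))\<^sup>2) \<le> V N * (T / \<delta>)" by simp
    qed (use Vpos in \<open>auto intro!: sum_nonneg\<close>)
    finally have "(\<Sum>i\<in>{m..<N}. a i * g i)\<^sup>2 \<le> (V N)\<^sup>2 * (T / \<delta>)" by (simp add: power2_eq_square)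
    then have "\<bar>\<Sum>i\<in>{m..<N}. a i * g i\<bar> \<le> \<bar>V N\<bar> * sqrt (T / \<delta>)"
      by (metis real_sqrt_abs real_sqrt_le_mono real_sqrt_mult)
    with Vpos show ?thesis by simp
  qed
  have "?G f p = (\<Sum>i<N. a i * g i)" unfolding g_def by (rule f_exp)
  also have "\<dots> = (\<Sum>i<m. a i * g i) + (\<Sum>i\<in>{m..<N}. a i * g i)"
    using mN by (metis lessThan_atLeast0 sum.atLeastLessThan_concat zero_le)
  also have "(\<Sum>i<m. a i * g i) \<le> (\<Sum>i<m. sqrt (V N) * (sqrt (innov_var 0) / \<delta>) * \<bar>y i\<bar>)"
    using mN term_bd by (intro sum_mono) auto
  finally show ?thesis using tail C unfolding y_def T_def by (simp add: sum_distrib_left)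
qed

text \<open>The bound of \<open>past_future_bound\<close>, divided by \<open>V N\<close>, is taken
  to the limit first in \<open>N\<close> with \<open>m\<close> fixed, which removes the early terms,
  and then in \<open>m\<close>, which removes the tail. This contradicts a block correlation of at
  least \<open>\<kappa>\<close>.\<close>

lemma innov_var_not_summable:
  fixes V :: "nat \<Rightarrow> real"
  assumes V: "\<And>N. V N = (\<Sum>i<N. \<Sum>j<N. r (int i - int j))"
    and \<kappa>: "0 < \<kappa>" "\<And>N. \<kappa> * V N \<le> (\<Sum>i<N. \<Sum>j<N. r (int (N + i) - int j))"
    and small: "\<And>j. (\<lambda>N. (\<Sum>k<N. r (int k - int j)) / sqrt (V N)) \<longlonglongrightarrow> 0"
  shows "\<not> summable (\<lambda>i. innov_var i - lim innov_var)"
proof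
  assume summ: "summable (\<lambda>i. innov_var i - lim innov_var)"
  let ?T = "\<lambda>m. (\<Sum>i. innov_var (i + m) - lim innov_var)"
  let ?E = "\<lambda>m N. \<Sum>i<m. \<bar>\<Sum>j<Suc i. innov i j * ((\<Sum>k<N. r (int k - int j)) / sqrt (V N))\<bar>"
  have "\<kappa> \<le> sqrt (?T m / \<delta>)" for m
  proof (rule tendsto_lowerbound)
    have "?E m \<longlonglongrightarrow> (\<Sum>i<m. \<bar>\<Sum>j<Suc i. innov i j * 0\<bar>)"
      by (intro tendsto_sum tendsto_rabs tendsto_mult tendsto_const small)
    then have "(\<lambda>N. (sqrt (innov_var 0) / \<delta>) * ?E m N + sqrt (?T m / \<delta>)) \<longlonglongrightarrow>
       (sqrt (innov_var 0) / \<delta>) * 0 + sqrt (?T m / \<delta>)"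
      by (intro tendsto_add tendsto_mult tendsto_const) simp
    then show "(\<lambda>N. (sqrt (innov_var 0) / \<delta>) * ?E m N + sqrt (?T m / \<delta>)) \<longlonglongrightarrow> sqrt (?T m / \<delta>)"
      by simp
    show "\<forall>\<^sub>F N in sequentially. \<kappa> \<le> (sqrt (innov_var 0) / \<delta>) * ?E m N + sqrt (?T m / \<delta>)"
      \<comment> \<open>The threshold ensures both \<open>m <= N\<close> and a nonempty block,
        whence \<open>V N\<close> is positive.\<close>
      using eventually_ge_at_top[of "max 1 m"]
    proof eventually_elim
      case (elim N)
      let ?c = "\<lambda>k. 1 :: real"
      have "V N = form N ?c ?c" unfolding form_def V by simp
      with form_ge_component[of 0 N ?c] elim delta_pos have Vpos: "0 < V N" by simp
      define Y where "Y i = (\<Sum>j<Suc i. innov i j * (\<Sum>k<N. r (int k - int j)))" for i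
      have "?E m N = (\<Sum>i<m. \<bar>Y i / sqrt (V N)\<bar>)"
        unfolding Y_def sum_divide_distrib[of "\<lambda>j. innov i j * z j" for i z] by simp
      also have "\<dots> = (\<Sum>i<m. \<bar>Y i\<bar>) / sqrt (V N)"
        unfolding sum_divide_distrib using Vpos by (simp add: abs_divide)
      finally have E: "?E m N = (\<Sum>i<m. \<bar>Y i\<bar>) / sqrt (V N)" .
      have "\<kappa> * V N \<le> sqrt (V N) * (sqrt (innov_var 0) / \<delta>) * (\<Sum>i<m. \<bar>Y i\<bar>) + V N * sqrt (?T m / \<delta>)"
        using past_future_bound[where m = m and N = N and V = V, OF summ _ _ V] \<kappa>(2)[of N] elim unfolding Y_def by auto
      also have "sqrt (V N) * (sqrt (innov_var 0) / \<delta>) * (\<Sum>i<m. \<bar>Y i\<bar>) =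
         V N * ((sqrt (innov_var 0) / \<delta>) * ((\<Sum>i<m. \<bar>Y i\<bar>) / sqrt (V N)))"
        by (subst real_div_sqrt[symmetric]) (use Vpos in \<open>simp_all add: mult_ac\<close>)
      finally have "V N * \<kappa> \<le> V N * ((sqrt (innov_var 0) / \<delta>) * ?E m N + sqrt (?T m / \<delta>))"
        unfolding E by (simp add: algebra_simps)
      with Vpos show ?case by simp
    qed
  qed simp
  moreover have "(\<lambda>m. sqrt (?T m / \<delta>)) \<longlonglongrightarrow> sqrt (0 / \<delta>)"
    by (intro tendsto_real_sqrt tendsto_divide tendsto_const suminf_exist_split2[OF summ]) (use delta_pos in auto)
  ultimately have "\<kappa> \<le> sqrt (0 / \<delta>)"
    by (intro LIMSEQ_le_const) auto
  with \<kappa>(1) show False by simp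
qed

end

section \<open>Uniqueness of characteristic functions in several variables\<close>

text \<open>Normalising a bounded nonnegative weight gives a probability law on the line, to which
  Levy's uniqueness theorem applies. Its characteristic function and its measure are the weighted
  integrals of interest.\<close>

lemma
  fixes W g :: "'a \<Rightarrow> real"
  assumes M: "finite_measure M" and W[measurable]: "W \<in> borel_measurable M"
    and g[measurable]: "g \<in> borel_measurable M"
    and bnd: "\<And>x. 0 \<le> W x" "\<And>x. W x \<le> C" and c: "c = (\<integral>x. W x \<partial>M)" "0 < c"
  defines "D \<equiv> distr (density M (\<lambda>x. ennreal (W x / c))) borel g"
  shows real_distribution_weighted: "real_distribution D"
    and char_weighted: "char D s = (\<integral>x. complex_of_real (W x) * iexp (s * g x) \<partial>M) / c"
    and measure_weighted: "A \<in> sets borel \<Longrightarrow> measure D A = (\<integral>x. W x * indicator A (g x) \<partial>M) / c"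
proof -
  interpret finite_measure M by fact
  have int: "integrable M W"
    using bnd by (intro integrable_const_bound[of _ C]) auto
  interpret D: prob_space "density M (\<lambda>x. ennreal (W x / c))"
  proof (rule prob_spaceI)
    have "emeasure (density M (\<lambda>x. ennreal (W x / c))) (space M) = (\<integral>\<^sup>+x. ennreal (W x / c) \<partial>M)"
      by (subst emeasure_density) (auto intro!: nn_integral_cong)
    also have "\<dots> = ennreal (\<integral>x. W x / c \<partial>M)"
      using int bnd c by (intro nn_integral_eq_integral) auto
    also have "\<dots> = 1" using c by simp
    finally show "emeasure (density M (\<lambda>x. ennreal (W x / c))) (space (density M (\<lambda>x. ennreal (W x / c)))) = 1"
      by simp
  qed
  show rd: "real_distribution D" unfolding D_def
    by (rule D.real_distribution_distr) simp
  show "char D s = (\<integral>x. complex_of_real (W x) * iexp (s * g x) \<partial>M) / c"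
    unfolding char_def D_def using bnd c
    by (simp add: integral_distr integral_density scaleR_conv_of_real)
  show "measure D A = (\<integral>x. W x * indicator A (g x) \<partial>M) / c" if [measurable]: "A \<in> sets borel"
  proof -
    interpret R: real_distribution D by fact
    have "measure D A = (\<integral>x. indicator A x \<partial>D)"
      using that by (simp add: R.events_eq_borel)
    also have "\<dots> = (\<integral>x. W x * indicator A (g x) \<partial>M) / c"
      unfolding D_def using bnd(1) c(2)
      by (subst integral_distr, simp, simp, subst integral_density) (auto simp: less_imp_le)
    finally show ?thesis .
  qed
qed

lemma weighted_law_eqI:
  fixes W g :: "'a \<Rightarrow> real"
  assumes M: "finite_measure M" "finite_measure N" and sets: "sets N = sets M"
    and W: "W \<in> borel_measurable M" and g: "g \<in> borel_measurable M"
    and bnd: "\<And>x. 0 \<le> W x" "\<And>x. W x \<le> C"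
    and eq: "\<And>s. (\<integral>x. complex_of_real (W x) * iexp (s * g x) \<partial>M) = (\<integral>x. complex_of_real (W x) * iexp (s * g x) \<partial>N)"
    and A: "A \<in> sets borel"
  shows "(\<integral>x. W x * indicator A (g x) \<partial>M) = (\<integral>x. W x * indicator A (g x) \<partial>N)"
proof -
  have W': "W \<in> borel_measurable N" and g': "g \<in> borel_measurable N"
    using W g by (simp_all add: measurable_cong_sets[OF sets refl])
  define c where "c = (\<integral>x. W x \<partial>M)"
  \<comment> \<open>Equality at \<open>s = 0\<close> says that the weight has the same total mass
    under both measures.\<close>
  have c': "c = (\<integral>x. W x \<partial>N)"
    using eq[of 0] by (simp add: c_def)
  show ?thesis
  proof (cases "c = 0")
    \<comment> \<open>Without mass there is nothing to normalise, but then the weight vanishes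
      almost everywhere under both measures.\<close>
    case True
    have z: "(\<integral>x. W x * indicator A (g x) \<partial>L) = 0"
      if L: "finite_measure L" "W \<in> borel_measurable L" "g \<in> borel_measurable L" "(\<integral>x. W x \<partial>L) = 0" for L
    proof -
      have "integrable L W"
        using bnd by (intro finite_measure.integrable_const_bound[OF L(1), of _ C] L) auto
      with L(4) have "AE x in L. W x = 0"
        using bnd by (subst (asm) integral_nonneg_eq_0_iff_AE) auto
      then show ?thesis by (intro integral_eq_zero_AE) auto
    qed
    show ?thesis using z[OF M(1) W g] z[OF M(2) W' g'] True c' c_def by simp
  next
    case False
    moreover have "0 \<le> c" unfolding c_def using bnd by simp
    ultimately have c: "0 < c" by simp
    note p = M(1) W g bnd c_def c and q = M(2) W' g' bnd c' c
    have "distr (density M (\<lambda>x. ennreal (W x / c))) borel g = distr (density N (\<lambda>x. ennreal (W x / c))) borel g"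
    proof (rule Levy_uniqueness)
      show "char (distr (density M (\<lambda>x. ennreal (W x / c))) borel g) = char (distr (density N (\<lambda>x. ennreal (W x / c))) borel g)"
        by (rule ext) (simp only: char_weighted[OF p] char_weighted[OF q] eq)
    qed (rule real_distribution_weighted[OF p] real_distribution_weighted[OF q])+
    then show ?thesis
      using measure_weighted[OF p A] measure_weighted[OF q A] c by simp
  qed
qed

lemma complex_of_real_cos_add:
  "complex_of_real (cos (a + b)) = (iexp b * iexp a + iexp (- b) * iexp (- a)) / 2"
  by (simp add: cos_of_real[symmetric] cos_exp_eq exp_add[symmetric] algebra_simps)

text \<open>
  Levy's uniqueness theorem needs positive measures, so the oscillating factor \<open>iexp \<theta>\<close> is
  recovered from the nonnegative weights \<open>P * (1 + cos (\<theta> + \<beta>))\<close> with \<open>\<beta> = 0\<close> and \<open>\<beta> = - pi / 2\<close>.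
\<close>

lemma char_indicator_step:
  fixes P g \<theta> :: "'a \<Rightarrow> real"
  assumes M: "finite_measure M" "finite_measure N" and sets: "sets N = sets M"
    and P: "P \<in> borel_measurable M" and g: "g \<in> borel_measurable M" and \<theta>: "\<theta> \<in> borel_measurable M"
    and bnd: "\<And>x. 0 \<le> P x" "\<And>x. P x \<le> 1"
    and eq: "\<And>s e. (\<integral>x. complex_of_real (P x) * iexp (s * g x + e * \<theta> x) \<partial>M) =
      (\<integral>x. complex_of_real (P x) * iexp (s * g x + e * \<theta> x) \<partial>N)"
    and A: "A \<in> sets borel"
  shows "(\<integral>x. complex_of_real (P x * indicator A (g x)) * iexp (\<theta> x) \<partial>M) =
      (\<integral>x. complex_of_real (P x * indicator A (g x)) * iexp (\<theta> x) \<partial>N)"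
proof -
  have P': "P \<in> borel_measurable N" and g': "g \<in> borel_measurable N" and \<theta>': "\<theta> \<in> borel_measurable N"
    using P g \<theta> by (simp_all add: measurable_cong_sets[OF sets refl])
  note p = M(1) P g \<theta> and q = M(2) P' g' \<theta>'
  have int: "integrable L (\<lambda>x. complex_of_real (P x) * iexp (s * g x + e * \<theta> x))"
    if "finite_measure L" "P \<in> borel_measurable L" "g \<in> borel_measurable L" "\<theta> \<in> borel_measurable L" for L s e
  proof -
    note that(2-4)[measurable]
    show ?thesis using bnd
      by (intro finite_measure.integrable_const_bound[OF that(1), of _ 1]) (auto simp: norm_mult)
  qed
  \<comment> \<open>Expanding the cosine leaves the frequencies \<open>0\<close>, \<open>e\<close>
    and \<open>- e\<close> in front of \<open>\<theta>\<close>, all of them covered by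
    \<open>eq\<close>.\<close>
  have exp_eq: "(\<integral>x. complex_of_real (P x * (1 + cos (e * \<theta> x + \<beta>))) * iexp (s * g x) \<partial>L) =
      (\<integral>x. complex_of_real (P x) * iexp (s * g x + 0 * \<theta> x) \<partial>L)
    + iexp \<beta> / 2 * (\<integral>x. complex_of_real (P x) * iexp (s * g x + e * \<theta> x) \<partial>L)
    + iexp (- \<beta>) / 2 * (\<integral>x. complex_of_real (P x) * iexp (s * g x + (- e) * \<theta> x) \<partial>L)"
    if L: "finite_measure L" "P \<in> borel_measurable L" "g \<in> borel_measurable L" "\<theta> \<in> borel_measurable L" for L s \<beta> e
  proof -
    have pt: "complex_of_real (P x * (1 + cos (e * \<theta> x + \<beta>))) * iexp (s * g x) =
       complex_of_real (P x) * iexp (s * g x + 0 * \<theta> x)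
      + iexp \<beta> / 2 * (complex_of_real (P x) * iexp (s * g x + e * \<theta> x))
      + iexp (- \<beta>) / 2 * (complex_of_real (P x) * iexp (s * g x + (- e) * \<theta> x))" for x
      by (simp add: complex_of_real_cos_add ring_distribs exp_add add_divide_distrib mult_ac)
         (simp add: exp_diff exp_minus divide_inverse)
    show ?thesis unfolding pt
      by (simp only: Bochner_Integration.integral_add integral_mult_right_zero Bochner_Integration.integrable_add integrable_mult_right int[OF L])
  qed
  have W: "(\<integral>x. P x * (1 + cos (e * \<theta> x + \<beta>)) * indicator A (g x) \<partial>M) =
     (\<integral>x. P x * (1 + cos (e * \<theta> x + \<beta>)) * indicator A (g x) \<partial>N)" for e \<beta>
  proof (rule weighted_law_eqI[OF M sets _ g _ _ _ A, where C = 2])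
    note P[measurable] \<theta>[measurable]
    show "(\<lambda>x. P x * (1 + cos (e * \<theta> x + \<beta>))) \<in> borel_measurable M" by simp
    show "0 \<le> P x * (1 + cos (e * \<theta> x + \<beta>))" for x
      using bnd[of x] cos_ge_minus_one[of "e * \<theta> x + \<beta>"] by (intro mult_nonneg_nonneg) linarith+
    show "P x * (1 + cos (e * \<theta> x + \<beta>)) \<le> 2" for x
    proof -
      have "P x * (1 + cos (e * \<theta> x + \<beta>)) \<le> 1 * 2"
        using bnd[of x] cos_ge_minus_one[of "e * \<theta> x + \<beta>"] cos_le_one[of "e * \<theta> x + \<beta>"]
        by (intro mult_mono) linarith+
      then show ?thesis by simp
    qed
  qed (simp only: exp_eq[OF p] exp_eq[OF q] eq)
  have intr: "integrable L (\<lambda>x. P x * indicator A (g x) * cos (e * \<theta> x + \<beta>))"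
    if "finite_measure L" "P \<in> borel_measurable L" "g \<in> borel_measurable L" "\<theta> \<in> borel_measurable L" for L e \<beta>
  proof -
    note that(2-4)[measurable] A[measurable]
    show ?thesis using bnd
      by (intro finite_measure.integrable_const_bound[OF that(1), of _ 1])
         (auto simp: abs_mult indicator_def intro!: mult_le_one)
  qed
  \<comment> \<open>\<open>cos (0 * \<theta> x + 0)\<close> stands for 1, so that
    \<open>intr\<close> covers both summands.\<close>
  have split: "(\<integral>x. P x * (1 + cos (e * \<theta> x + \<beta>)) * indicator A (g x) \<partial>L) =
     (\<integral>x. P x * indicator A (g x) * cos (0 * \<theta> x + 0) \<partial>L) + (\<integral>x. P x * indicator A (g x) * cos (e * \<theta> x + \<beta>) \<partial>L)"
    if "finite_measure L" "P \<in> borel_measurable L" "g \<in> borel_measurable L" "\<theta> \<in> borel_measurable L" for L e \<beta>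
    by (subst Bochner_Integration.integral_add[symmetric, OF intr intr])
       (auto intro!: that Bochner_Integration.integral_cong simp: algebra_simps)
  \<comment> \<open>At \<open>e = 0\<close> and \<open>\<beta> = 0\<close> the weight is
    \<open>2 * P x\<close>, which settles the constant part; subtracting it leaves the cosine
    part.\<close>
  have cos_eq: "(\<integral>x. P x * indicator A (g x) * cos (e * \<theta> x + \<beta>) \<partial>M) = (\<integral>x. P x * indicator A (g x) * cos (e * \<theta> x + \<beta>) \<partial>N)" for e \<beta>
    using W[of e \<beta>] W[of 0 0] unfolding split[OF p] split[OF q] by linarith
  have final: "(\<integral>x. complex_of_real (P x * indicator A (g x)) * iexp (\<theta> x) \<partial>L) =
     complex_of_real (\<integral>x. P x * indicator A (g x) * cos (1 * \<theta> x + 0) \<partial>L) +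
     \<i> * complex_of_real (\<integral>x. P x * indicator A (g x) * cos (1 * \<theta> x + (- (pi / 2))) \<partial>L)"
    if L: "finite_measure L" "P \<in> borel_measurable L" "g \<in> borel_measurable L" "\<theta> \<in> borel_measurable L" for L
  proof -
    have "iexp (\<theta> x) = complex_of_real (cos (1 * \<theta> x + 0)) + \<i> * complex_of_real (cos (1 * \<theta> x + (- (pi / 2))))" for x
    proof -
      have "cos (1 * \<theta> x + (- (pi / 2))) = sin (\<theta> x)" by (simp add: cos_diff)
      then show ?thesis by (simp add: exp_Euler cos_of_real sin_of_real)
    qed
    then have pt: "complex_of_real (P x * indicator A (g x)) * iexp (\<theta> x) =
       complex_of_real (P x * indicator A (g x) * cos (1 * \<theta> x + 0))
       + \<i> * complex_of_real (P x * indicator A (g x) * cos (1 * \<theta> x + (- (pi / 2))))" for x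
      by (simp only: of_real_mult distrib_left mult_ac)
    show ?thesis unfolding pt
      by (simp only: Bochner_Integration.integral_add integral_mult_right_zero integral_complex_of_real
          integrable_mult_right integrable_of_real intr[OF L])
  qed
  show ?thesis unfolding final[OF p] final[OF q] cos_eq ..
qed

text \<open>One coordinate at a time, \<open>char_indicator_step\<close> replaces the oscillating
  factor by the indicator of a Borel set. Once all coordinates are treated, the equality says that
  the measures agree on boxes, which determine them.\<close>

theorem char_uniqueness_PiM:
  fixes \<mu> \<nu> :: "('i \<Rightarrow> real) measure"
  assumes I: "finite I" and \<mu>: "finite_measure \<mu>" and \<nu>: "finite_measure \<nu>"
    and sets_\<mu>: "sets \<mu> = sets (PiM I (\<lambda>_. borel))" and sets_\<nu>: "sets \<nu> = sets (PiM I (\<lambda>_. borel))"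
    and eq: "\<And>t. (\<integral>x. iexp (\<Sum>k\<in>I. t k * x k) \<partial>\<mu>) = (\<integral>x. iexp (\<Sum>k\<in>I. t k * x k) \<partial>\<nu>)"
  shows "\<mu> = \<nu>"
proof -
  have main: "(\<integral>x. complex_of_real (\<Prod>j\<in>J. indicator (A j) (x j)) * iexp (\<Sum>k\<in>I - J. t k * x k) \<partial>\<mu>) =
     (\<integral>x. complex_of_real (\<Prod>j\<in>J. indicator (A j) (x j)) * iexp (\<Sum>k\<in>I - J. t k * x k) \<partial>\<nu>)"
    if "finite J" "J \<subseteq> I" and A: "\<And>j. A j \<in> sets borel" for J A t
    using that(1,2)
  proof (induction J arbitrary: t rule: finite_induct)
    case empty
    show ?case using eq[of t] by simp
  next
    case (insert j J)
    define P where "P x = (\<Prod>j\<in>J. indicator (A j) (x j) :: real)" for x :: "'i \<Rightarrow> real"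
    define \<theta> where "\<theta> x = (\<Sum>k\<in>I - insert j J. t k * x k)" for x :: "'i \<Rightarrow> real"
    note A[measurable]
    have comp: "(\<lambda>x. x k) \<in> borel_measurable \<mu>" if "k \<in> I" for k
      using that by (simp add: measurable_cong_sets[OF sets_\<mu> refl] measurable_component_singleton)
    have Pm: "P \<in> borel_measurable \<mu>" unfolding P_def[abs_def]
      using insert.prems by (intro borel_measurable_prod measurable_compose[OF comp]) auto
    have \<theta>m: "\<theta> \<in> borel_measurable \<mu>" unfolding \<theta>_def[abs_def]
      by (intro borel_measurable_sum borel_measurable_times comp) auto
    have j: "I - J = insert j (I - insert j J)" using insert by auto
    \<comment> \<open>The induction hypothesis is used with frequency \<open>s\<close> at
      \<open>j\<close> and the remaining frequencies scaled by \<open>e\<close>, the two free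
      parameters of \<open>char_indicator_step\<close>.\<close>
    have IH: "(\<integral>x. complex_of_real (P x) * iexp (s * x j + e * \<theta> x) \<partial>\<mu>) = (\<integral>x. complex_of_real (P x) * iexp (s * x j + e * \<theta> x) \<partial>\<nu>)" for s e
    proof -
      have "(\<Sum>k\<in>I - J. (if k = j then s else e * t k) * x k) = s * x j + e * \<theta> x" for x :: "'i \<Rightarrow> real"
      proof -
        have "(\<Sum>k\<in>I - J. (if k = j then s else e * t k) * x k) =
          s * x j + (\<Sum>k\<in>I - insert j J. (if k = j then s else e * t k) * x k)"
          unfolding j using I by (subst sum.insert) auto
        also have "(\<Sum>k\<in>I - insert j J. (if k = j then s else e * t k) * x k) = e * \<theta> x"
          unfolding \<theta>_def sum_distrib_left by (intro sum.cong) auto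
        finally show ?thesis .
      qed
      then show ?thesis
        using insert.IH[of "\<lambda>k. if k = j then s else e * t k"] insert.prems by (simp add: P_def)
    qed
    have "(\<integral>x. complex_of_real (P x * indicator (A j) (x j)) * iexp (\<theta> x) \<partial>\<mu>) =
      (\<integral>x. complex_of_real (P x * indicator (A j) (x j)) * iexp (\<theta> x) \<partial>\<nu>)"
      by (rule char_indicator_step[OF \<mu> \<nu> _ Pm _ \<theta>m _ _ IH A])
         (use insert.prems in \<open>auto simp: sets_\<mu> sets_\<nu> P_def intro!: comp prod_nonneg prod_le_1\<close>)
    then show ?case
      using insert.hyps by (simp add: P_def \<theta>_def mult_ac)
  qed
  have box: "emeasure L (Pi\<^sub>E I A) = ennreal (Re (\<integral>x. complex_of_real (\<Prod>j\<in>I. indicator (A j) (x j)) * iexp (\<Sum>k\<in>I - I. 0 * x k) \<partial>L))"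
    if L: "finite_measure L" "sets L = sets (PiM I (\<lambda>_. borel))" and A: "\<And>j. A j \<in> sets (borel :: real measure)" for L A
  proof -
    interpret finite_measure L by fact
    have E: "Pi\<^sub>E I A \<in> sets L" using L(2) A I by (simp add: sets_PiM_I_finite)
    have sp: "space L = (\<Pi>\<^sub>E i\<in>I. UNIV)" using sets_eq_imp_space_eq[OF L(2)] by (simp add: space_PiM)
    have "(\<integral>x. complex_of_real (\<Prod>j\<in>I. indicator (A j) (x j)) * iexp (\<Sum>k\<in>I - I. 0 * x k) \<partial>L) =
       (\<integral>x. complex_of_real (indicator (Pi\<^sub>E I A) x) \<partial>L)"
      using I by (intro Bochner_Integration.integral_cong refl)
        (auto simp: sp indicator_def PiE_iff extensional_def prod_zero_iff intro!: prod.neutral)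
    also have "\<dots> = complex_of_real (measure L (Pi\<^sub>E I A))"
      using E by simp
    finally show ?thesis by (simp add: emeasure_eq_measure)
  qed
  show ?thesis
  proof (rule measure_eqI_PiM_finite[OF I sets_\<mu> sets_\<nu>])
    fix A :: "'i \<Rightarrow> real set" assume A: "\<And>i. i \<in> I \<Longrightarrow> A i \<in> sets borel"
    \<comment> \<open>\<open>main\<close> and \<open>box\<close> ask for Borel sets at every index,
      also outside \<open>I\<close>.\<close>
    define A' where "A' i = (if i \<in> I then A i else UNIV)" for i
    have A': "A' i \<in> sets borel" for i using A by (simp add: A'_def)
    have "Pi\<^sub>E I A = Pi\<^sub>E I A'" by (intro PiE_cong) (simp add: A'_def)
    then show "emeasure \<mu> (Pi\<^sub>E I A) = emeasure \<nu> (Pi\<^sub>E I A)"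
      using box[OF \<mu> sets_\<mu> A'] box[OF \<nu> sets_\<nu> A'] main[where J = I and A = A' and t = "\<lambda>_. 0", OF I subset_refl A'] by simp
  next
    show "range (\<lambda>i::nat. \<Pi>\<^sub>E i\<in>I. UNIV :: real set) \<subseteq> prod_algebra I (\<lambda>_. borel)"
      using I by (auto intro!: prod_algebraI_finite)
    show "(\<Union>i::nat. \<Pi>\<^sub>E i\<in>I. UNIV) = space (Pi\<^sub>M I (\<lambda>_. borel :: real measure))" by (simp add: space_PiM)
    show "emeasure \<mu> (\<Pi>\<^sub>E i\<in>I. UNIV) \<noteq> \<infinity>" for i :: nat
      using finite_measure.emeasure_finite[OF \<mu>] by simp
  qed
qed

section \<open>Entropy of Gaussian vectors\<close>

lemma integral_normal_density_iexp:
  assumes \<sigma>: "0 < \<sigma>"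
  shows "(\<integral>y. complex_of_real (normal_density \<mu> \<sigma> y) * iexp (t * y) \<partial>lborel) =
    iexp (t * \<mu>) * complex_of_real (exp (- (t\<^sup>2 * \<sigma>\<^sup>2) / 2))"
proof -
  have std: "(\<integral>y. complex_of_real (std_normal_density y) * iexp (s * y) \<partial>lborel) =
      complex_of_real (exp (- s\<^sup>2 / 2))" for s
    using fun_cong[OF char_std_normal_distribution, of s]
    by (simp add: char_def integral_density scaleR_conv_of_real)
  have dens: "normal_density \<mu> \<sigma> (\<mu> + \<sigma> * x) = std_normal_density x / \<sigma>" for x
    using \<sigma> by (simp add: normal_density_def real_sqrt_mult power_mult_distrib)
  have "(\<integral>y. complex_of_real (normal_density \<mu> \<sigma> y) * iexp (t * y) \<partial>lborel) =
     \<bar>\<sigma>\<bar> *\<^sub>R (\<integral>x. complex_of_real (normal_density \<mu> \<sigma> (\<mu> + \<sigma> * x)) * iexp (t * (\<mu> + \<sigma> * x)) \<partial>lborel)"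
    using \<sigma> by (intro lborel_integral_real_affine) simp
  also have "(\<lambda>x. complex_of_real (normal_density \<mu> \<sigma> (\<mu> + \<sigma> * x)) * iexp (t * (\<mu> + \<sigma> * x))) =
     (\<lambda>x. (iexp (t * \<mu>) / \<sigma>) * (complex_of_real (std_normal_density x) * iexp ((t * \<sigma>) * x)))"
    unfolding dens by (rule ext) (simp add: distrib_left exp_add mult_ac)
  also have "\<bar>\<sigma>\<bar> *\<^sub>R (\<integral>x. (iexp (t * \<mu>) / \<sigma>) * (complex_of_real (std_normal_density x) * iexp ((t * \<sigma>) * x)) \<partial>lborel) =
     iexp (t * \<mu>) * complex_of_real (exp (- (t * \<sigma>)\<^sup>2 / 2))"
    unfolding integral_mult_right_zero std using \<sigma> by (simp add: scaleR_conv_of_real)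
  finally show ?thesis by (simp add: power_mult_distrib)
qed

context toeplitz_form
begin

lemma innov_var_pos: "0 < innov_var n"
  using innov_var_ge[of n] delta_pos by linarith

section \<open>The joint Gaussian density built from successive predictions\<close>

definition predict :: "nat \<Rightarrow> (nat \<Rightarrow> real) \<Rightarrow> real" where
  "predict n x = (\<Sum>j<n. predictor n j * x j)"

text \<open>The chain rule: given the past, variable \<open>k\<close> is normal around its linear
  prediction with variance \<open>innov_var k\<close>.\<close>

definition gauss_density :: "nat \<Rightarrow> (nat \<Rightarrow> real) \<Rightarrow> real" where
  "gauss_density n x = (\<Prod>k<n. normal_density (predict k x) (sqrt (innov_var k)) (x k))"

lemma gauss_density_nonneg: "0 \<le> gauss_density n x"
  unfolding gauss_density_def by (intro prod_nonneg) auto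

lemma measurable_component_lborel:
  "k < n \<Longrightarrow> (\<lambda>x. x k) \<in> borel_measurable (PiM {..<n} (\<lambda>_. lborel :: real measure))"
  using measurable_component_singleton[of k "{..<n}" "\<lambda>_. lborel :: real measure"] by simp

lemma measurable_predict:
  "k \<le> n \<Longrightarrow> predict k \<in> borel_measurable (PiM {..<n} (\<lambda>_. lborel :: real measure))"
  unfolding predict_def[abs_def]
  by (intro borel_measurable_sum borel_measurable_times borel_measurable_const measurable_component_lborel) auto

lemma measurable_gauss_density:
  "gauss_density n \<in> borel_measurable (PiM {..<n} (\<lambda>_. lborel :: real measure))"
proof -
  have "(\<lambda>x. normal_density (predict k x) (sqrt (innov_var k)) (x k)) \<in>
      borel_measurable (PiM {..<n} (\<lambda>_. lborel :: real measure))" if "k < n" for k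
  proof -
    note measurable_component_lborel[OF that, measurable]
      measurable_predict[OF less_imp_le[OF that], measurable]
    show ?thesis unfolding normal_density_def by measurable
  qed
  then show ?thesis unfolding gauss_density_def[abs_def] by (intro borel_measurable_prod) auto
qed

lemma gauss_density_Suc:
  "gauss_density (Suc n) (x(n := y)) = gauss_density n x * normal_density (predict n x) (sqrt (innov_var n)) y"
proof -
  have "predict k (x(n := y)) = predict k x" if "k \<le> n" for k
    using that unfolding predict_def by (intro sum.cong) auto
  then show ?thesis unfolding gauss_density_def by simp
qed

lemma nn_integral_gauss_density: "(\<integral>\<^sup>+x. gauss_density n x \<partial>PiM {..<n} (\<lambda>_. lborel)) = 1"
proof (induction n)
  case 0
  show ?case by (simp add: gauss_density_def PiM_empty nn_integral_count_space_finite)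
next
  case (Suc n)
  interpret product_sigma_finite "\<lambda>_. lborel :: real measure" ..
  have one: "(\<integral>\<^sup>+y. normal_density m (sqrt (innov_var n)) y \<partial>lborel) = 1" for m
    by (subst nn_integral_eq_integral) (simp_all add: innov_var_pos)
  have "(\<integral>\<^sup>+x. gauss_density (Suc n) x \<partial>PiM {..<Suc n} (\<lambda>_. lborel)) =
     (\<integral>\<^sup>+x. \<integral>\<^sup>+y. gauss_density (Suc n) (x(n := y)) \<partial>lborel \<partial>PiM {..<n} (\<lambda>_. lborel))"
    using measurable_gauss_density[of "Suc n"] unfolding lessThan_Suc
    by (intro product_nn_integral_insert) auto
  also have "\<dots> = (\<integral>\<^sup>+x. gauss_density n x \<partial>PiM {..<n} (\<lambda>_. lborel))"
    by (simp add: gauss_density_Suc ennreal_mult' gauss_density_nonneg nn_integral_cmult one)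
  finally show ?case using Suc by simp
qed

lemma integrable_gauss_density: "integrable (PiM {..<n} (\<lambda>_. lborel)) (gauss_density n)"
  using measurable_gauss_density nn_integral_gauss_density
  by (intro integrableI_nonneg) (auto simp: gauss_density_nonneg)

text \<open>Completing the square: the last variable is its prediction plus an orthogonal
  innovation, and the prediction is merged into the other coefficients.\<close>

lemma form_Suc:
  "form (Suc n) t t = (t n)\<^sup>2 * innov_var n + form n (\<lambda>k. t k + t n * predictor n k) (\<lambda>k. t k + t n * predictor n k)"
proof -
  define d where "d k = (if k < n then t k + t n * predictor n k else 0)" for k
  have "form (Suc n) t t = form (Suc n) (\<lambda>k. d k + t n * innov n k) (\<lambda>k. d k + t n * innov n k)"
    by (intro form_cong) (auto simp: d_def innov_def less_Suc_eq)
  also have "\<dots> = form (Suc n) d d + (t n)\<^sup>2 * innov_var n"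
    unfolding form_add_square form_commute[of _ d "innov n"]
  proof -
    have "form (Suc n) (innov n) d = 0" by (rule form_innov_left) (simp_all add: d_def)
    then show "form (Suc n) d d + 2 * t n * form (Suc n) (innov n) d + (t n)\<^sup>2 * form (Suc n) (innov n) (innov n) =
      form (Suc n) d d + (t n)\<^sup>2 * innov_var n"
      by (simp add: innov_var_def)
  qed
  also have "form (Suc n) d d = form n d d" by (rule form_restrict) (auto simp: d_def)
  also have "\<dots> = form n (\<lambda>k. t k + t n * predictor n k) (\<lambda>k. t k + t n * predictor n k)"
    by (rule form_cong) (auto simp: d_def)
  finally show ?thesis by simp
qed

text \<open>Integrating out the last coordinate yields the Gaussian factor of its innovation and
  adds \<open>t n\<close> times the predictor to the remaining frequencies, which is the recursion
  \<open>form_Suc\<close>.\<close>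

lemma char_gauss_density:
  "(\<integral>x. complex_of_real (gauss_density n x) * iexp (\<Sum>k<n. t k * x k) \<partial>PiM {..<n} (\<lambda>_. lborel)) =
     complex_of_real (exp (- form n t t / 2))"
proof (induction n arbitrary: t)
  case 0
  show ?case by (simp add: gauss_density_def form_def PiM_empty)
next
  case (Suc n)
  interpret product_sigma_finite "\<lambda>_. lborel :: real measure" ..
  let ?f = "\<lambda>x. complex_of_real (gauss_density (Suc n) x) * iexp (\<Sum>k<Suc n. t k * x k)"
  let ?s = "\<lambda>k. t k + t n * predictor n k"
  have meas: "?f \<in> borel_measurable (PiM {..<Suc n} (\<lambda>_. lborel))"
  proof -
    have [measurable]: "(\<lambda>x. \<Sum>k<Suc n. t k * x k) \<in> borel_measurable (PiM {..<Suc n} (\<lambda>_. lborel :: real measure))"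
      by (intro borel_measurable_sum borel_measurable_times borel_measurable_const measurable_component_lborel) auto
    note measurable_gauss_density[measurable]
    show ?thesis by measurable
  qed
  have int: "integrable (PiM {..<Suc n} (\<lambda>_. lborel)) ?f"
    by (rule Bochner_Integration.integrable_bound[OF integrable_gauss_density meas])
       (auto simp: norm_mult)
  have inner: "(\<integral>y. ?f (x(n := y)) \<partial>lborel) =
      complex_of_real (exp (- ((t n)\<^sup>2 * innov_var n) / 2)) *
      (complex_of_real (gauss_density n x) * iexp (\<Sum>k<n. ?s k * x k))" for x
  proof -
    have "?f (x(n := y)) = (complex_of_real (gauss_density n x) * iexp (\<Sum>k<n. t k * x k)) *
      (complex_of_real (normal_density (predict n x) (sqrt (innov_var n)) y) * iexp (t n * y))" for y
      by (simp add: gauss_density_Suc distrib_left exp_add mult_ac)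
    then have "(\<integral>y. ?f (x(n := y)) \<partial>lborel) = (complex_of_real (gauss_density n x) * iexp (\<Sum>k<n. t k * x k)) *
      (iexp (t n * predict n x) * complex_of_real (exp (- ((t n)\<^sup>2 * (sqrt (innov_var n))\<^sup>2) / 2)))"
      using integral_normal_density_iexp[of "sqrt (innov_var n)" "predict n x" "t n"] innov_var_pos
      by (simp only: integral_mult_right_zero real_sqrt_gt_0_iff)
    also have "(\<Sum>k<n. ?s k * x k) = (\<Sum>k<n. t k * x k) + t n * predict n x"
      by (simp add: predict_def distrib_right sum.distrib sum_distrib_left mult.assoc)
    note s = this
    show ?thesis unfolding s calculation
      using innov_var_pos[of n] by (simp add: distrib_left exp_add mult_ac)
  qed
  have "(\<integral>x. ?f x \<partial>PiM {..<Suc n} (\<lambda>_. lborel)) =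
     (\<integral>x. \<integral>y. ?f (x(n := y)) \<partial>lborel \<partial>PiM {..<n} (\<lambda>_. lborel))"
    using int unfolding lessThan_Suc by (intro product_integral_insert) auto
  also have "\<dots> = complex_of_real (exp (- ((t n)\<^sup>2 * innov_var n) / 2)) * complex_of_real (exp (- form n ?s ?s / 2))"
    unfolding inner integral_mult_right_zero Suc.IH ..
  also have "\<dots> = complex_of_real (exp (- form (Suc n) t t / 2))"
    unfolding form_Suc[of n t] of_real_mult[symmetric] exp_add[symmetric]
    by (simp add: add_divide_distrib)
  finally show ?case .
qed

lemma gaussian_vector_distributed:
  fixes X :: "nat \<Rightarrow> 'a \<Rightarrow> real"
  assumes M: "prob_space M" and X[measurable]: "\<And>k. X k \<in> borel_measurable M"
    and char: "\<And>t. (\<integral>\<omega>. iexp (\<Sum>k<n. t k * X k \<omega>) \<partial>M) = complex_of_real (exp (- form n t t / 2))"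
  shows "distributed M (PiM {..<n} (\<lambda>_. lborel)) (\<lambda>\<omega>. \<lambda>k\<in>{..<n}. X k \<omega>) (gauss_density n)"
proof -
  interpret prob_space M by fact
  let ?P = "PiM {..<n} (\<lambda>_. lborel :: real measure)"
  have sP: "sets ?P = sets (PiM {..<n} (\<lambda>_. borel :: real measure))"
    by (rule sets_PiM_cong) simp_all
  have Xm[measurable]: "(\<lambda>\<omega>. \<lambda>k\<in>{..<n}. X k \<omega>) \<in> measurable M ?P"
    by (rule measurable_restrict) simp
  note measurable_gauss_density[measurable]
  have lin[measurable]: "(\<lambda>x. \<Sum>k<n. t k * x k) \<in> borel_measurable ?P" for t
    by (intro borel_measurable_sum borel_measurable_times borel_measurable_const measurable_component_lborel) auto
  have "distr M ?P (\<lambda>\<omega>. \<lambda>k\<in>{..<n}. X k \<omega>) = density ?P (\<lambda>x. ennreal (gauss_density n x))"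
  proof (rule char_uniqueness_PiM[where I = "{..<n}"])
    show "finite_measure (distr M ?P (\<lambda>\<omega>. \<lambda>k\<in>{..<n}. X k \<omega>))"
      by (rule finite_measure_distr) simp
    show "finite_measure (density ?P (\<lambda>x. ennreal (gauss_density n x)))"
      by (intro finite_measureI) (simp add: emeasure_density nn_integral_gauss_density cong: nn_integral_cong)
    fix t
    have "(\<integral>x. iexp (\<Sum>k<n. t k * x k) \<partial>distr M ?P (\<lambda>\<omega>. \<lambda>k\<in>{..<n}. X k \<omega>)) =
        (\<integral>\<omega>. iexp (\<Sum>k<n. t k * X k \<omega>) \<partial>M)"
      by (subst integral_distr) (auto intro!: Bochner_Integration.integral_cong)
    also have "\<dots> = (\<integral>x. iexp (\<Sum>k<n. t k * x k) \<partial>density ?P (\<lambda>x. ennreal (gauss_density n x)))"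
      unfolding char char_gauss_density[symmetric]
      by (subst integral_density) (auto simp: gauss_density_nonneg scaleR_conv_of_real)
    finally show "(\<integral>x. iexp (\<Sum>k<n. t k * x k) \<partial>distr M ?P (\<lambda>\<omega>. \<lambda>k\<in>{..<n}. X k \<omega>)) =
      (\<integral>x. iexp (\<Sum>k<n. t k * x k) \<partial>density ?P (\<lambda>x. ennreal (gauss_density n x)))" .
  qed (simp_all add: sP)
  then show ?thesis unfolding distributed_def by simp
qed

text \<open>The log density is a sum of constants and scaled squared prediction errors. Each squared
  error is quadratic in the variables, so the covariances alone give its mean
  \<open>innov_var k\<close>.\<close>

lemma gaussian_vector_entropy:
  fixes X :: "nat \<Rightarrow> 'a \<Rightarrow> real"
  assumes M: "prob_space M" and X[measurable]: "\<And>k. X k \<in> borel_measurable M"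
    and char: "\<And>t. (\<integral>\<omega>. iexp (\<Sum>k<n. t k * X k \<omega>) \<partial>M) = complex_of_real (exp (- form n t t / 2))"
    and int: "\<And>i j. integrable M (\<lambda>\<omega>. X i \<omega> * X j \<omega>)"
    and cov: "\<And>i j. (\<integral>\<omega>. X i \<omega> * X j \<omega> \<partial>M) = r (int i - int j)"
  shows "prob_space.entropy M (exp 1) (PiM {..<n} (\<lambda>_. lborel)) (\<lambda>\<omega>. \<lambda>k\<in>{..<n}. X k \<omega>) =
    (\<Sum>k<n. ln (2 * pi * exp 1 * innov_var k) / 2)"
proof -
  interpret prob_space M by fact
  interpret information_space M "exp 1" by standard simp
  let ?P = "PiM {..<n} (\<lambda>_. lborel :: real measure)"
  let ?X = "\<lambda>\<omega>. \<lambda>k\<in>{..<n}. X k \<omega>"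
  note D = gaussian_vector_distributed[OF M X char]
  have sq: "(X k \<omega> - predict k (?X \<omega>))\<^sup>2 = (\<Sum>i<Suc k. \<Sum>j<Suc k. innov k i * innov k j * (X i \<omega> * X j \<omega>))"
    if "k < n" for k \<omega>
  proof -
    have "(\<Sum>i<k. innov k i * X i \<omega>) = (\<Sum>i<k. - (predictor k i * X i \<omega>))"
      by (intro sum.cong) (auto simp: innov_def)
    moreover have "predict k (?X \<omega>) = (\<Sum>i<k. predictor k i * X i \<omega>)"
      unfolding predict_def using that by (intro sum.cong) auto
    ultimately have "X k \<omega> - predict k (?X \<omega>) = (\<Sum>i<Suc k. innov k i * X i \<omega>)"
      by (simp add: innov_simps sum_negf)
    then show ?thesis by (simp only: power2_eq_square sum_product mult_ac)
  qed
  have isq: "integrable M (\<lambda>\<omega>. (X k \<omega> - predict k (?X \<omega>))\<^sup>2)" if "k < n" for k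
    unfolding sq[OF that] by (intro Bochner_Integration.integrable_sum integrable_mult_right int)
  have esq: "(\<integral>\<omega>. (X k \<omega> - predict k (?X \<omega>))\<^sup>2 \<partial>M) = innov_var k" if "k < n" for k
    unfolding sq[OF that] innov_var_def form_def
    by (simp only: Bochner_Integration.integral_sum Bochner_Integration.integrable_sum integrable_mult_right int
        integral_mult_right_zero cov)
  have ld: "log (exp 1) (gauss_density n (?X \<omega>)) =
     (\<Sum>k<n. - ln (2 * pi * innov_var k) / 2 - (X k \<omega> - predict k (?X \<omega>))\<^sup>2 / (2 * innov_var k))" for \<omega>
  proof -
    have "ln (gauss_density n (?X \<omega>)) = (\<Sum>k<n. ln (normal_density (predict k (?X \<omega>)) (sqrt (innov_var k)) (?X \<omega> k)))"
      unfolding gauss_density_def by (intro ln_prod) (auto simp: less_imp_neq[OF normal_density_pos, symmetric] innov_var_pos)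
    also have "\<dots> = (\<Sum>k<n. - ln (2 * pi * innov_var k) / 2 - (X k \<omega> - predict k (?X \<omega>))\<^sup>2 / (2 * innov_var k))"
    proof (intro sum.cong refl)
      fix k assume "k \<in> {..<n}"
      have p: "0 < 2 * pi * innov_var k" using innov_var_pos[of k] by simp
      have "normal_density (predict k (?X \<omega>)) (sqrt (innov_var k)) (?X \<omega> k) =
        1 / sqrt (2 * pi * innov_var k) * exp (- (X k \<omega> - predict k (?X \<omega>))\<^sup>2 / (2 * innov_var k))"
        using \<open>k \<in> _\<close> innov_var_pos[of k] by (simp add: normal_density_def)
      also have "ln \<dots> = - ln (sqrt (2 * pi * innov_var k)) + - (X k \<omega> - predict k (?X \<omega>))\<^sup>2 / (2 * innov_var k)"
        using p by (subst ln_mult) (simp_all add: ln_div)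
      finally show "ln (normal_density (predict k (?X \<omega>)) (sqrt (innov_var k)) (?X \<omega> k)) =
        - ln (2 * pi * innov_var k) / 2 - (X k \<omega> - predict k (?X \<omega>))\<^sup>2 / (2 * innov_var k)"
        using ln_sqrt[OF less_imp_le[OF p]] by (simp del: restrict_apply)
    qed
    finally show ?thesis by (simp add: log_def)
  qed
  note measurable_gauss_density[measurable]
  have "entropy (exp 1) ?P ?X = - (\<integral>x. gauss_density n x * log (exp 1) (gauss_density n x) \<partial>?P)"
    by (rule entropy_distr[OF D]) (rule gauss_density_nonneg)
  also have "(\<integral>x. gauss_density n x * log (exp 1) (gauss_density n x) \<partial>?P) =
     (\<integral>\<omega>. log (exp 1) (gauss_density n (?X \<omega>)) \<partial>M)"
    by (rule distributed_integral[OF D]) (auto simp: gauss_density_nonneg)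
  also have "\<dots> = (\<Sum>k<n. - ln (2 * pi * innov_var k) / 2 - innov_var k / (2 * innov_var k))"
    unfolding ld by (subst Bochner_Integration.integral_sum) (simp_all add: isq esq prob_space)
  \<comment> \<open>Each squared error contributes \<open>1 / 2\<close>, absorbed into the logarithm
    as the factor \<open>exp 1\<close>.\<close>
  also have "- \<dots> = (\<Sum>k<n. ln (2 * pi * exp 1 * innov_var k) / 2)"
  proof -
    have "ln (2 * pi * exp 1 * innov_var k) = ln (2 * pi * innov_var k) + 1" for k
      using innov_var_pos[of k] ln_mult[of "2 * pi * innov_var k" "exp 1"] by (simp add: mult_ac)
    then show ?thesis using innov_var_pos
      by (simp add: sum_negf[symmetric] add_divide_distrib less_imp_neq[symmetric] add.commute)
  qed
  finally show ?thesis .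
qed

end

section \<open>Fractional Gaussian noise\<close>

definition fgn_acov :: "real \<Rightarrow> int \<Rightarrow> real" where
  "fgn_acov H k = (\<bar>k - 1\<bar> powr (2 * H) - 2 * \<bar>k\<bar> powr (2 * H) + \<bar>k + 1\<bar> powr (2 * H)) / 2"

lemma fgn_acov_minus: "fgn_acov H (- k) = fgn_acov H k"
proof -
  have "\<bar>- real_of_int k - 1\<bar> = \<bar>real_of_int k + 1\<bar>" "\<bar>1 - real_of_int k\<bar> = \<bar>real_of_int k - 1\<bar>"
    by linarith+
  then show ?thesis by (simp add: fgn_acov_def)
qed

lemma fgn_acov_fdiff: "fgn_acov H (int k + 1) = fdiff 2 (2 * H) (real k) / 2"
  by (simp add: fgn_acov_def numeral_2_eq_2 add.commute)

text \<open>The second difference of the autocovariance at lag 1, that is, the largest amount by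
  which lag 0 can be lowered without losing convexity there.\<close>

definition fgn_coercivity :: "real \<Rightarrow> real" where
  "fgn_coercivity H = (7 - 4 * 2 powr (2 * H) + 3 powr (2 * H)) / 2"

text \<open>Polya's criterion is applied to the autocovariance lowered at lag 0; the amount removed
  reappears as a multiple of the identity, which is the coercivity bound.\<close>

lemma fgn_toeplitz_form:
  assumes H: "1 / 2 < H" "H < 1"
  shows "toeplitz_form (fgn_acov H) (fgn_coercivity H)"
proof
  show "fgn_acov H (- k) = fgn_acov H k" for k by (rule fgn_acov_minus)
  show "0 < fgn_coercivity H"
    using powr_2_3_pos[of "2 * H"] H by (simp add: fgn_coercivity_def)
  fix n :: nat and c :: "nat \<Rightarrow> real"
  define a where "a k = fgn_acov H (int k) - (if k = 0 then fgn_coercivity H else 0)" for k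
  have aS: "a (Suc k) = fdiff 2 (2 * H) (real k) / 2" for k
    using fgn_acov_fdiff[of H k] by (simp add: a_def add.commute)
  note signs = fdiff_signs[of "2 * H"]
  have "0 \<le> (\<Sum>i<n. \<Sum>j<n. c i * c j * a (nat \<bar>int i - int j\<bar>))"
  proof (cases n)
    case (Suc n')
    show ?thesis
    proof (rule polya_psd)
      fix m :: nat assume "1 \<le> m"
      show "0 \<le> a (m - 1) - 2 * a m + a (Suc m)"
      proof (cases "m = 1")
        \<comment> \<open>Only this second difference involves lag 0; it is 0 by the choice of the
          constant.\<close>
        case True
        have "a 0 = 1 - fgn_coercivity H" "a 1 = (2 powr (2 * H) - 2) / 2"
          "a 2 = (1 - 2 * 2 powr (2 * H) + 3 powr (2 * H)) / 2"
          by (simp_all add: a_def fgn_acov_def)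
        moreover have "(1 - (7 - 4 * u + v) / 2) - 2 * ((u - 2) / 2) + (1 - 2 * u + v) / 2 = 0" for u v :: real
          by (simp add: field_simps)
        ultimately have "a 0 - 2 * a 1 + a 2 = 0" by (simp only: fgn_coercivity_def)
        with True show ?thesis by (simp add: numeral_2_eq_2)
      next
        case False
        define k where "k = m - 2"
        have m: "m = Suc (Suc k)" using False \<open>1 \<le> m\<close> by (simp add: k_def)
        have "a (m - 1) - 2 * a m + a (Suc m) = fdiff 4 (2 * H) (real k) / 2"
          unfolding m by (simp add: aS fdiff_4_eq add_ac)
        then show ?thesis using signs[of "real k"] H by simp
      qed
    next
      have "a n - a (Suc n) = - fdiff 3 (2 * H) (real n') / 2"
        unfolding Suc by (simp add: aS fdiff_3_eq add_ac)
      then show "a (Suc n) \<le> a n" using signs[of "real n'"] H by simp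
      show "0 \<le> a (Suc n)" using signs[of "real n"] H by (simp add: aS)
    qed
  qed simp
  also have "(\<Sum>i<n. \<Sum>j<n. c i * c j * a (nat \<bar>int i - int j\<bar>)) =
      (\<Sum>i<n. \<Sum>j<n. c i * c j * fgn_acov H (int i - int j) - (if i = j then fgn_coercivity H * (c i)\<^sup>2 else 0))"
  proof (intro sum.cong refl)
    fix i j
    have "fgn_acov H (int (nat \<bar>int i - int j\<bar>)) = fgn_acov H (int i - int j)"
      using fgn_acov_minus[of H "int i - int j"] by (cases "j \<le> i") auto
    then show "c i * c j * a (nat \<bar>int i - int j\<bar>) =
      c i * c j * fgn_acov H (int i - int j) - (if i = j then fgn_coercivity H * (c i)\<^sup>2 else 0)"
      by (simp add: a_def algebra_simps power2_eq_square)
  qed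
  also have "\<dots> = (\<Sum>i<n. \<Sum>j<n. c i * c j * fgn_acov H (int i - int j)) - fgn_coercivity H * (\<Sum>i<n. (c i)\<^sup>2)"
    by (simp add: sum_subtractf sum_distrib_left cong: if_cong)
  finally show "fgn_coercivity H * (\<Sum>i<n. (c i)\<^sup>2) \<le> (\<Sum>i<n. \<Sum>j<n. c i * c j * fgn_acov H (int i - int j))"
    by simp
qed

section \<open>Covariances of block sums of fractional Gaussian noise\<close>

lemma sum_fgn_acov:
  "(\<Sum>k<N. fgn_acov H (int k + c)) =
    (\<bar>int N + c\<bar> powr (2 * H) - \<bar>int N + c - 1\<bar> powr (2 * H) - (\<bar>c\<bar> powr (2 * H) - \<bar>c - 1\<bar> powr (2 * H))) / 2"
  by (induction N) (simp_all add: fgn_acov_def field_simps)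

text \<open>The autocovariance is a second difference, so the double sum telescopes twice. The
  offset covers both the variance of a block, \<open>c = 0\<close>, and the covariance of adjacent
  blocks, \<open>c = int N\<close>.\<close>

lemma sum_sum_fgn_acov:
  "(\<Sum>i<N. \<Sum>j<N. fgn_acov H (int i - int j + c)) =
    (\<bar>int N + c\<bar> powr (2 * H) - 2 * \<bar>c\<bar> powr (2 * H) + \<bar>c - int N\<bar> powr (2 * H)) / 2"
proof -
  have tele: "(\<Sum>j<m. \<bar>d - int j\<bar> powr (2 * H) - \<bar>d - int j - 1\<bar> powr (2 * H)) =
     \<bar>d\<bar> powr (2 * H) - \<bar>d - int m\<bar> powr (2 * H)" for m :: nat and d :: int
    by (induction m) (simp_all add: algebra_simps)
  have "(\<Sum>i<N. \<Sum>j<N. fgn_acov H (int i - int j + c)) = (\<Sum>j<N. \<Sum>i<N. fgn_acov H (int i + (c - int j)))"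
    by (subst sum.swap) (simp add: algebra_simps)
  also have "\<dots> = ((\<Sum>j<N. \<bar>(int N + c) - int j\<bar> powr (2 * H) - \<bar>(int N + c) - int j - 1\<bar> powr (2 * H)) -
     (\<Sum>j<N. \<bar>c - int j\<bar> powr (2 * H) - \<bar>c - int j - 1\<bar> powr (2 * H))) / 2"
    unfolding sum_fgn_acov sum_subtractf[symmetric] sum_divide_distrib
    by (intro sum.cong refl) (simp add: algebra_simps)
  also have "\<dots> = (\<bar>int N + c\<bar> powr (2 * H) - 2 * \<bar>c\<bar> powr (2 * H) + \<bar>c - int N\<bar> powr (2 * H)) / 2"
    unfolding tele by simp
  finally show ?thesis by simp
qed

lemma fgn_block_variance: "(\<Sum>i<N. \<Sum>j<N. fgn_acov H (int i - int j)) = real N powr (2 * H)"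
  using sum_sum_fgn_acov[where N = N and H = H and c = 0] by simp

lemma fgn_past_future_covariance:
  "(\<Sum>i<N. \<Sum>j<N. fgn_acov H (int (N + i) - int j)) = (2 powr (2 * H) - 2) / 2 * real N powr (2 * H)"
proof -
  have "(\<Sum>i<N. \<Sum>j<N. fgn_acov H (int (N + i) - int j)) = (\<Sum>i<N. \<Sum>j<N. fgn_acov H (int i - int j + int N))"
    by (simp add: algebra_simps)
  also have "\<dots> = ((2 * real N) powr (2 * H) - 2 * real N powr (2 * H)) / 2"
    unfolding sum_sum_fgn_acov by simp
  finally show ?thesis by (simp add: powr_mult field_simps)
qed

text \<open>The covariance of a block sum with a fixed variable telescopes to first differences of a
  power, of order at most \<open>N powr (2 * H - 1)\<close>. The standard deviation of the block is
  \<open>N powr H\<close>, and the quotient decays because \<open>H < 1\<close>.\<close>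

lemma fgn_covariance_block_small:
  assumes H: "1 / 2 < H" "H < 1"
  shows "(\<lambda>N. (\<Sum>k<N. fgn_acov H (int k - int j)) / sqrt (real N powr (2 * H))) \<longlonglongrightarrow> 0"
proof (rule Lim_null_comparison)
  define C where "C = \<bar>\<bar>- int j\<bar> powr (2 * H) - \<bar>- int j - 1\<bar> powr (2 * H)\<bar>"
  have lim: "(\<lambda>N. real N powr (- s)) \<longlonglongrightarrow> 0" if "0 < s" for s
    using that by (intro tendsto_neg_powr filterlim_real_sequentially) simp
  have "(\<lambda>N. (2 * H * real N powr (- (1 - H)) + C * real N powr (- H)) / 2) \<longlonglongrightarrow> (2 * H * 0 + C * 0) / 2"
    using H by (intro tendsto_divide tendsto_add tendsto_mult tendsto_const lim) auto
  then show "(\<lambda>N. (2 * H * real N powr (- (1 - H)) + C * real N powr (- H)) / 2) \<longlonglongrightarrow> 0" by simp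
  show "\<forall>\<^sub>F N in sequentially. norm ((\<Sum>k<N. fgn_acov H (int k - int j)) / sqrt (real N powr (2 * H)))
    \<le> (2 * H * real N powr (- (1 - H)) + C * real N powr (- H)) / 2"
    using eventually_gt_at_top[of "Suc j"]
  proof eventually_elim
    case (elim N)
    define t where "t = real N - real j"
    have t: "1 < t" "t \<le> real N" using elim by (auto simp: t_def)
    have Npos: "0 < real N" using elim by simp
    have "\<exists>z>t - 1. z < t \<and> t powr (2 * H) - (t - 1) powr (2 * H) = (t - (t - 1)) * (2 * H * z powr (2 * H - 1))"
      using t by (intro MVT2) (auto intro!: derivative_eq_intros)
    then obtain z where z: "t - 1 < z" "z < t" "t powr (2 * H) - (t - 1) powr (2 * H) = 2 * H * z powr (2 * H - 1)"
      by auto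
    have "z powr (2 * H - 1) \<le> real N powr (2 * H - 1)" using z t H by (intro powr_mono2) auto
    then have g: "\<bar>t powr (2 * H) - (t - 1) powr (2 * H)\<bar> \<le> 2 * H * real N powr (2 * H - 1)"
      unfolding z(3) using H by (simp add: abs_mult)
    have "(\<Sum>k<N. fgn_acov H (int k - int j)) =
       (t powr (2 * H) - (t - 1) powr (2 * H) - (\<bar>- int j\<bar> powr (2 * H) - \<bar>- int j - 1\<bar> powr (2 * H))) / 2"
      using sum_fgn_acov[where N = N and H = H and c = "- int j"] t by (simp add: t_def)
    moreover have "\<bar>(u - v) / 2\<bar> \<le> (w + \<bar>v\<bar>) / 2" if "\<bar>u\<bar> \<le> w" for u v w :: real
      using abs_triangle_ineq4[of u v] that by (simp add: abs_divide)
    ultimately have "\<bar>\<Sum>k<N. fgn_acov H (int k - int j)\<bar> \<le> (2 * H * real N powr (2 * H - 1) + C) / 2"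
      using g unfolding C_def by (simp only:)
    then have "\<bar>\<Sum>k<N. fgn_acov H (int k - int j)\<bar> / real N powr H \<le> (2 * H * real N powr (2 * H - 1) + C) / 2 / real N powr H"
      by (intro divide_right_mono) auto
    also have "\<dots> = (2 * H * real N powr (- (1 - H)) + C * real N powr (- H)) / 2"
    proof -
      have "real N powr (2 * H - 1) / real N powr H = real N powr (- (1 - H))"
        by (simp add: powr_diff[symmetric])
      moreover have "C / real N powr H = C * real N powr (- H)" by (simp add: powr_minus divide_inverse)
      moreover have "(2 * H * p + C) / 2 / q = (2 * H * (p / q) + C / q) / 2" for p q :: real
        by (simp add: add_divide_distrib)
      ultimately show ?thesis by (simp only:)
    qed
    also have "real N powr H = sqrt (real N powr (2 * H))"
      by (rule real_sqrt_unique[symmetric]) (simp_all add: power2_eq_square powr_add[symmetric])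
    finally show ?case by (simp add: abs_divide)
  qed
qed

text \<open>Turns the limit of the entropy gains into the entropy rate.\<close>

lemma cesaro_mean:
  fixes a :: "nat \<Rightarrow> real"
  assumes "a \<longlonglongrightarrow> L"
  shows "(\<lambda>n. (\<Sum>k<n. a k) / real n) \<longlonglongrightarrow> L"
proof (rule LIMSEQ_I)
  fix e :: real assume e: "0 < e"
  obtain K where K: "\<And>k. K \<le> k \<Longrightarrow> \<bar>a k - L\<bar> < e / 2"
    using LIMSEQ_D[OF assms, of "e / 2"] e by auto
  define C where "C = (\<Sum>k<K. \<bar>a k - L\<bar>)"
  obtain n0 where n0: "2 * C / e < real n0" using reals_Archimedean2 by blast
  have "norm ((\<Sum>k<n. a k) / real n - L) < e" if n: "max n0 (Suc K) \<le> n" for n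
  proof -
    have npos: "0 < real n" using n by simp
    have "2 * C / e < real n" using n0 n by simp
    then have C: "C < e / 2 * real n" using e by (simp add: field_simps)
    have "(\<Sum>k<n. a k) / real n - L = (\<Sum>k<n. a k - L) / real n"
      using npos by (simp add: sum_subtractf field_simps)
    also have "norm \<dots> = \<bar>\<Sum>k<n. a k - L\<bar> / real n" by simp
    also have "\<dots> \<le> (\<Sum>k<n. \<bar>a k - L\<bar>) / real n" by (intro divide_right_mono sum_abs) auto
    also have "(\<Sum>k<n. \<bar>a k - L\<bar>) = C + (\<Sum>k\<in>{K..<n}. \<bar>a k - L\<bar>)"
      unfolding C_def lessThan_atLeast0 using n by (intro sum.atLeastLessThan_concat[symmetric]) auto
    also have "(\<Sum>k\<in>{K..<n}. \<bar>a k - L\<bar>) \<le> (\<Sum>k\<in>{K..<n}. e / 2)"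
      by (rule sum_mono, rule less_imp_le, rule K) simp
    also have "(\<Sum>k\<in>{K..<n}. e / 2) \<le> e / 2 * real n" using e n by (simp add: field_simps)
    finally have "norm ((\<Sum>k<n. a k) / real n - L) \<le> (C + e / 2 * real n) / real n"
      using npos by (simp add: divide_right_mono)
    also have "\<dots> < (e / 2 * real n + e / 2 * real n) / real n"
      using C npos by (intro divide_strict_right_mono) auto
    also have "\<dots> = e" using npos by (simp add: field_simps)
    finally show ?thesis .
  qed
  then show "\<exists>no. \<forall>n\<ge>no. norm ((\<Sum>k<n. a k) / real n - L) < e" by blast
qed

section \<open>Centered Gaussian variables\<close>

lemma gaussian_rv_measurable: "gaussian_rv M Y \<Longrightarrow> Y \<in> borel_measurable M"
  unfolding gaussian_rv_def by (auto dest: distributed_measurable)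

text \<open>One formula serves both cases of \<open>gaussian_rv\<close>: a degenerate law of mean 0
  is concentrated at 0, which is the case of variance 0.\<close>

lemma gaussian_rv_centered:
  assumes M: "prob_space M" and G: "gaussian_rv M Y" and mean: "(\<integral>\<omega>. Y \<omega> \<partial>M) = 0"
  shows "integrable M Y" "integrable M (\<lambda>\<omega>. (Y \<omega>)\<^sup>2)"
    "(\<integral>\<omega>. iexp (Y \<omega>) \<partial>M) = complex_of_real (exp (- (\<integral>\<omega>. (Y \<omega>)\<^sup>2 \<partial>M) / 2))"
proof -
  interpret prob_space M by fact
  note Ym[measurable] = gaussian_rv_measurable[OF G]
  from G consider (normal) \<mu> \<sigma> where "0 < \<sigma>" "distributed M lborel Y (\<lambda>x. ennreal (normal_density \<mu> \<sigma> x))"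
    | (const) \<mu> where "distr M borel Y = return borel \<mu>"
    unfolding gaussian_rv_def by blast
  then have "integrable M Y \<and> integrable M (\<lambda>\<omega>. (Y \<omega>)\<^sup>2) \<and>
    (\<integral>\<omega>. iexp (Y \<omega>) \<partial>M) = complex_of_real (exp (- (\<integral>\<omega>. (Y \<omega>)\<^sup>2 \<partial>M) / 2))"
  proof cases
    case normal
    have \<mu>: "\<mu> = 0" using normal_distributed_expectation[OF normal] mean by simp
    note D = normal(2)[unfolded \<mu>]
    have "integrable M Y"
      using distributed_integrable[OF D, of "\<lambda>x. x"] integrable_normal_moment[OF normal(1), of 0 1] by simp
    moreover have "integrable M (\<lambda>\<omega>. (Y \<omega>)\<^sup>2)"
      using distributed_integrable[OF D, of "\<lambda>x. x\<^sup>2"] integrable_normal_moment[OF normal(1), of 0 2] by simp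
    moreover have "(\<integral>\<omega>. (Y \<omega>)\<^sup>2 \<partial>M) = \<sigma>\<^sup>2"
      using normal_distributed_variance[OF normal(1) D] mean by simp
    moreover have "(\<integral>\<omega>. iexp (Y \<omega>) \<partial>M) = complex_of_real (exp (- \<sigma>\<^sup>2 / 2))"
    proof -
      have "(\<integral>\<omega>. iexp (Y \<omega>) \<partial>M) = (\<integral>y. iexp y \<partial>distr M lborel Y)"
        by (subst integral_distr) auto
      also have "\<dots> = (\<integral>y. complex_of_real (normal_density 0 \<sigma> y) * iexp (1 * y) \<partial>lborel)"
        unfolding distributed_distr_eq_density[OF D]
        by (subst integral_density) (auto simp: scaleR_conv_of_real)
      finally show ?thesis unfolding integral_normal_density_iexp[OF normal(1)] by simp
    qed
    ultimately show ?thesis by simp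
  next
    case const
    have "AE y in distr M borel Y. y = \<mu>"
      unfolding const by (subst AE_return) auto
    then have ae: "AE \<omega> in M. Y \<omega> = \<mu>" by (subst (asm) AE_distr_iff) auto
    have "(\<integral>\<omega>. Y \<omega> \<partial>M) = (\<integral>\<omega>. \<mu> \<partial>M)" by (rule integral_cong_AE) (use ae in auto)
    then have \<mu>: "\<mu> = 0" using mean prob_space by simp
    have "integrable M Y \<longleftrightarrow> integrable M (\<lambda>_. 0 :: real)"
      by (rule integrable_cong_AE) (use ae \<mu> in auto)
    moreover have "integrable M (\<lambda>\<omega>. (Y \<omega>)\<^sup>2) \<longleftrightarrow> integrable M (\<lambda>_. 0 :: real)"
      by (rule integrable_cong_AE) (use ae \<mu> in auto)
    moreover have "(\<integral>\<omega>. (Y \<omega>)\<^sup>2 \<partial>M) = (\<integral>\<omega>. 0 \<partial>M)"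
      by (rule integral_cong_AE) (use ae \<mu> in auto)
    moreover have "(\<integral>\<omega>. iexp (Y \<omega>) \<partial>M) = (\<integral>\<omega>. 1 \<partial>M)"
      by (rule integral_cong_AE) (use ae \<mu> in auto)
    ultimately show ?thesis using prob_space by simp
  qed
  then show "integrable M Y" "integrable M (\<lambda>\<omega>. (Y \<omega>)\<^sup>2)"
    "(\<integral>\<omega>. iexp (Y \<omega>) \<partial>M) = complex_of_real (exp (- (\<integral>\<omega>. (Y \<omega>)\<^sup>2 \<partial>M) / 2))" by auto
qed

lemma integrable_mult_of_squares:
  fixes f g :: "'a \<Rightarrow> real"
  assumes "f \<in> borel_measurable M" "g \<in> borel_measurable M"
    and "integrable M (\<lambda>x. (f x)\<^sup>2)" "integrable M (\<lambda>x. (g x)\<^sup>2)"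
  shows "integrable M (\<lambda>x. f x * g x)"
proof (rule Bochner_Integration.integrable_bound)
  show "integrable M (\<lambda>x. (f x)\<^sup>2 + (g x)\<^sup>2)" using assms by simp
  show "(\<lambda>x. f x * g x) \<in> borel_measurable M" using assms by simp
  have "\<bar>a * b\<bar> \<le> a\<^sup>2 + b\<^sup>2" for a b :: real
  proof -
    have "2 * \<bar>a * b\<bar> \<le> a\<^sup>2 + b\<^sup>2"
      using sum_squares_bound[of "\<bar>a\<bar>" "\<bar>b\<bar>"] by (simp add: abs_mult)
    with abs_ge_zero[of "a * b"] show ?thesis by linarith
  qed
  then show "AE x in M. norm (f x * g x) \<le> norm ((f x)\<^sup>2 + (g x)\<^sup>2)" by simp
qed

text \<open>The Gaussian hypothesis concerns combinations of values of \<open>B\<close>; summation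
  by parts turns a combination of increments into one of these.\<close>

lemma sum_increments_by_parts:
  fixes b :: "nat \<Rightarrow> real"
  shows "(\<Sum>k<n. t k * (b (Suc k) - b k)) =
    (\<Sum>i\<le>n. ((if i = 0 then 0 else t (i - 1)) - (if i < n then t i else 0)) * b i)"
proof -
  have "(\<Sum>i\<le>n. (if i = 0 then 0 else t (i - 1)) * b i) = (\<Sum>i<n. t i * b (Suc i))"
    by (subst sum.atMost_shift) simp
  moreover have "(\<Sum>i\<le>n. (if i < n then t i else 0) * b i) = (\<Sum>i<n. t i * b i)"
    by (intro sum.mono_neutral_cong_right) auto
  ultimately show ?thesis
    by (simp only: left_diff_distrib right_diff_distrib sum_subtractf)
qed

section \<open>Increments of fractional Brownian motion\<close>

context
  fixes M :: "'a measure" and H :: real and B :: "real \<Rightarrow> 'a \<Rightarrow> real"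
  assumes M: "prob_space M" and fbm: "fractional_brownian_motion M H B"
begin

lemma fbm_mean: "0 \<le> t \<Longrightarrow> (\<integral>\<omega>. B t \<omega> \<partial>M) = 0"
  using fbm unfolding fractional_brownian_motion_def by blast

lemma fbm_covariance:
  "0 \<le> t \<Longrightarrow> 0 \<le> s \<Longrightarrow> (\<integral>\<omega>. B t \<omega> * B s \<omega> \<partial>M) =
    (\<bar>t\<bar> powr (2 * H) + \<bar>s\<bar> powr (2 * H) - \<bar>t - s\<bar> powr (2 * H)) / 2"
  using fbm unfolding fractional_brownian_motion_def by blast

lemma fbm_gaussian:
  "finite S \<Longrightarrow> S \<subseteq> {0..} \<Longrightarrow> gaussian_rv M (\<lambda>\<omega>. \<Sum>t\<in>S. c t * B t \<omega>)"
  using fbm unfolding fractional_brownian_motion_def gaussian_process_def by blast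

lemma fbm_gaussian_rv: "0 \<le> t \<Longrightarrow> gaussian_rv M (B t)"
  using fbm_gaussian[of "{t}" "\<lambda>_. 1"] by simp

lemma fbm_measurable: "0 \<le> t \<Longrightarrow> B t \<in> borel_measurable M"
  by (intro gaussian_rv_measurable fbm_gaussian_rv)

lemma fbm_integrable: "0 \<le> t \<Longrightarrow> integrable M (B t)"
  by (rule gaussian_rv_centered(1)[OF M fbm_gaussian_rv fbm_mean])

lemma fbm_integrable_mult: "0 \<le> t \<Longrightarrow> 0 \<le> s \<Longrightarrow> integrable M (\<lambda>\<omega>. B t \<omega> * B s \<omega>)"
  by (intro integrable_mult_of_squares fbm_measurable gaussian_rv_centered(2)[OF M fbm_gaussian_rv fbm_mean])

lemma fgn_measurable: "fractional_gaussian_noise B k \<in> borel_measurable M"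
proof -
  note fbm_measurable[of "real k", measurable] fbm_measurable[of "real k + 1", measurable]
  show ?thesis unfolding fractional_gaussian_noise_def[abs_def] by measurable
qed

lemma fgn_mult:
  "fractional_gaussian_noise B i \<omega> * fractional_gaussian_noise B j \<omega> =
    B (real i + 1) \<omega> * B (real j + 1) \<omega> - B (real i + 1) \<omega> * B (real j) \<omega>
    - (B (real i) \<omega> * B (real j + 1) \<omega> - B (real i) \<omega> * B (real j) \<omega>)"
  unfolding fractional_gaussian_noise_def by (simp add: algebra_simps)

lemma fgn_integrable_mult:
  "integrable M (\<lambda>\<omega>. fractional_gaussian_noise B i \<omega> * fractional_gaussian_noise B j \<omega>)"
  unfolding fgn_mult by (intro Bochner_Integration.integrable_diff fbm_integrable_mult) auto

lemma fgn_covariance: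
  "(\<integral>\<omega>. fractional_gaussian_noise B i \<omega> * fractional_gaussian_noise B j \<omega> \<partial>M) = fgn_acov H (int i - int j)"
proof -
  have "(\<integral>\<omega>. fractional_gaussian_noise B i \<omega> * fractional_gaussian_noise B j \<omega> \<partial>M) =
     (\<integral>\<omega>. B (real i + 1) \<omega> * B (real j + 1) \<omega> \<partial>M) - (\<integral>\<omega>. B (real i + 1) \<omega> * B (real j) \<omega> \<partial>M)
    - ((\<integral>\<omega>. B (real i) \<omega> * B (real j + 1) \<omega> \<partial>M) - (\<integral>\<omega>. B (real i) \<omega> * B (real j) \<omega> \<partial>M))"
    unfolding fgn_mult by (simp add: fbm_integrable_mult)
  also have "\<dots> = fgn_acov H (int i - int j)"
    using abs_minus_commute[of "real j" "1 + real i"]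
    by (simp add: fbm_covariance fgn_acov_def field_simps)
  finally show ?thesis .
qed

lemma fgn_combination_centered_gaussian:
  "gaussian_rv M (\<lambda>\<omega>. \<Sum>k<n. t k * fractional_gaussian_noise B k \<omega>)"
  "(\<integral>\<omega>. (\<Sum>k<n. t k * fractional_gaussian_noise B k \<omega>) \<partial>M) = 0"
proof -
  \<comment> \<open>Times are real numbers here, so the coefficient belonging to an integer time is
    read off through the floor.\<close>
  define c where "c s = ((if s = 0 then 0 else t (nat \<lfloor>s\<rfloor> - 1)) - (if nat \<lfloor>s\<rfloor> < n then t (nat \<lfloor>s\<rfloor>) else 0))" for s :: real
  have "(\<Sum>k<n. t k * fractional_gaussian_noise B k \<omega>) = (\<Sum>s\<in>real ` {..n}. c s * B s \<omega>)" for \<omega>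
    using sum_increments_by_parts[of t "\<lambda>i. B (real i) \<omega>" n]
    by (simp add: sum.reindex c_def fractional_gaussian_noise_def add.commute cong: if_cong)
  moreover have "gaussian_rv M (\<lambda>\<omega>. \<Sum>s\<in>real ` {..n}. c s * B s \<omega>)"
    by (rule fbm_gaussian) auto
  ultimately show "gaussian_rv M (\<lambda>\<omega>. \<Sum>k<n. t k * fractional_gaussian_noise B k \<omega>)" by simp
  show "(\<integral>\<omega>. (\<Sum>k<n. t k * fractional_gaussian_noise B k \<omega>) \<partial>M) = 0"
    unfolding fractional_gaussian_noise_def by (simp add: fbm_integrable fbm_mean)
qed

lemma fgn_block_entropy:
  assumes H: "1 / 2 < H" "H < 1"
  shows "block_entropy M (fractional_gaussian_noise B) n =
    (\<Sum>k<n. ln (2 * pi * exp 1 * toeplitz_form.innov_var (fgn_acov H) k) / 2)"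
proof -
  interpret toeplitz_form "fgn_acov H" "fgn_coercivity H" by (rule fgn_toeplitz_form[OF H])
  let ?X = "fractional_gaussian_noise B"
  have "(\<integral>\<omega>. (\<Sum>k<n. t k * ?X k \<omega>)\<^sup>2 \<partial>M) = form n t t" for t
  proof -
    have "(\<Sum>k<n. t k * ?X k \<omega>)\<^sup>2 = (\<Sum>i<n. \<Sum>j<n. t i * t j * (?X i \<omega> * ?X j \<omega>))" for \<omega>
      by (simp only: power2_eq_square sum_product mult_ac)
    then show ?thesis unfolding form_def
      by (simp only: Bochner_Integration.integral_sum Bochner_Integration.integrable_sum
          integrable_mult_right fgn_integrable_mult integral_mult_right_zero fgn_covariance)
  qed
  then have "(\<integral>\<omega>. iexp (\<Sum>k<n. t k * ?X k \<omega>) \<partial>M) = complex_of_real (exp (- form n t t / 2))" for t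
    using gaussian_rv_centered(3)[OF M fgn_combination_centered_gaussian[of t n]] by simp
  from gaussian_vector_entropy[OF M fgn_measurable this fgn_integrable_mult fgn_covariance]
  show ?thesis by (cases "n = 0") (simp_all add: block_entropy_def)
qed

end

theorem theorem4p1:
  fixes M :: "'a measure" and H :: real and B :: "real \<Rightarrow> 'a \<Rightarrow> real"
  assumes "prob_space M"
    and "1/2 < H" and "H < 1"
    and "fractional_brownian_motion M H B"
  shows "excess_entropy M (fractional_gaussian_noise B) = \<infinity>"
proof (rule ccontr)
  interpret toeplitz_form "fgn_acov H" "fgn_coercivity H" by (rule fgn_toeplitz_form[OF assms(2,3)])
  let ?X = "fractional_gaussian_noise B"
  let ?s = "lim innov_var"
  define e where "e k = ln (2 * pi * exp 1 * innov_var k) / 2" for k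
  define e' where "e' = ln (2 * pi * exp 1 * ?s) / 2"
  have block: "block_entropy M ?X n = (\<Sum>k<n. e k)" for n
    unfolding e_def by (rule fgn_block_entropy[OF assms(1,4,2,3)])
  have spos: "0 < ?s" using lim_innov_var_ge delta_pos by linarith
  have "e \<longlonglongrightarrow> e'" unfolding e_def[abs_def] e'_def
    using spos by (intro tendsto_intros lim_innov_var) auto
  from limI[OF cesaro_mean[OF this]] have rate: "entropy_rate M ?X = e'"
    unfolding entropy_rate_def block .
  \<comment> \<open>The bound \<open>ln x <= x - 1\<close>, at the ratio of the limit to the current
    variance, makes the entropy gap at least linear in the variance gap; the largest variance
    \<open>innov_var 0\<close> gives a uniform constant.\<close>
  have ge: "(innov_var k - ?s) / (2 * innov_var 0) \<le> e k - e'" for k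
  proof -
    have "e k - e' = - ln (?s / innov_var k) / 2"
      using spos innov_var_pos[of k] by (simp add: e_def e'_def ln_mult ln_div field_simps)
    moreover have "ln (?s / innov_var k) \<le> ?s / innov_var k - 1"
      using spos innov_var_pos[of k] by (intro ln_le_minus_one) simp
    moreover have "1 - ?s / innov_var k = (innov_var k - ?s) / innov_var k"
      using innov_var_pos[of k] by (simp add: field_simps)
    moreover have "(innov_var k - ?s) / innov_var 0 \<le> (innov_var k - ?s) / innov_var k"
      using decseqD[OF decseq_innov_var, of 0 k] lim_innov_var_le[of k] innov_var_pos
      by (intro divide_left_mono) auto
    ultimately show ?thesis by (simp add: field_simps)
  qed
  have nonneg: "0 \<le> (innov_var k - ?s) / (2 * innov_var 0)" for k
    using lim_innov_var_le[of k] innov_var_pos[of 0] by simp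
  assume "excess_entropy M ?X \<noteq> \<infinity>"
  \<comment> \<open>The gain at \<open>Suc n\<close> is the single term \<open>e n\<close>, in
    agreement with the shifted index of the series. As the terms are nonnegative, a sum other than
    infinity means summability.\<close>
  moreover have "excess_entropy M ?X = (\<Sum>n. ereal (e n - e'))"
    unfolding excess_entropy_def entropy_gain_def rate block by simp
  ultimately have "summable (\<lambda>n. e n - e')"
    using order_trans[OF nonneg ge] by (intro summable_ereal) auto
  then have "summable (\<lambda>k. (innov_var k - ?s) / (2 * innov_var 0))"
    by (rule summable_comparison_test'[where N = 0]) (simp only: real_norm_def abs_of_nonneg[OF nonneg] ge)
  then have "summable (\<lambda>k. innov_var k - ?s)"
    using innov_var_pos[of 0] by simp
  moreover have "\<not> summable (\<lambda>k. innov_var k - ?s)"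
  proof (rule innov_var_not_summable[where V = "\<lambda>N. real N powr (2 * H)" and \<kappa> = "(2 powr (2 * H) - 2) / 2"])
    show "0 < (2 powr (2 * H) - 2) / (2 :: real)"
      \<comment> \<open>Here \<open>1/2 < H\<close> makes the correlation of adjacent blocks
        strictly positive.\<close>
      using powr_less_mono[of 1 "2 * H" 2] assms(2) by simp
  qed (simp_all only: fgn_block_variance fgn_past_future_covariance order_refl
      fgn_covariance_block_small[OF assms(2,3)])
  ultimately show False by contradiction
qed

end
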